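(* There exists a function $f$ with $f(n)=o(n)$ such that for all integers $m\ge1$, $0\le n\le m$ and every $S\subseteq[m]$ with $|S|=n$, there is a representation of $S$ using at most $\mathcal{B}(n,m)+f(n)$ bits from which $\mathrm{rank}(x,S)$ ($x\in[m]$) and $\mathrm{select}(i,S)$ ($1\le i\le n$) can each be answered with $O(1)$ cell probes in the cell probe model with word size $\Theta(\lg m)$.
   Context: $[m]=\{0,\dots,m-1\}$, $\lg=\log_2$, $\mathcal{B}(n,m)=\lceil\lg\binom{m}{n}\rceil$. $\mathrm{rank}(x,S)$ returns $-1$ if $x\notin S$ and $|\{y\in S:y<x\}|$ otherwise; $\mathrm{select}(i,S)$ returns the $i$-th smallest element of $S$. In the cell probe model, memory consists of cells (words) of a given size, and the cost of a query is only the number of cells read; all other computation is free. $O(1)$ means a bound independent of $n,m,S$. *)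

theory Defs
  imports Complex_Main "HOL-Library.Landau_Symbols"
begin

definition info_bound :: "nat \<Rightarrow> nat \<Rightarrow> int" where
  "info_bound n m = \<lceil>log 2 (real (m choose n))\<rceil>"

definition set_rank :: "nat \<Rightarrow> nat set \<Rightarrow> int" where
  "set_rank x S = (if x \<in> S then int (card {y \<in> S. y < x}) else -1)"

text \<open>Positions are counted from 1, so the argument \<open>1\<close> selects the minimum.\<close>

definition set_select :: "nat \<Rightarrow> nat set \<Rightarrow> nat" where
  "set_select i S = sorted_list_of_set S ! (i - 1)"

text \<open>A bit string laid out in cells of \<open>w\<close> bits each. Positions beyond the end of the string
  read as \<open>False\<close>: every read yields exactly \<open>w\<close> bits, so the length of the string is not an
  additional channel of information.\<close>

definition cell :: "nat \<Rightarrow> bool list \<Rightarrow> nat \<Rightarrow> bool list" where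
  "cell w bs a = map (\<lambda>i. i < length bs \<and> bs ! i) [a * w ..< a * w + w]"

text \<open>An adaptive query algorithm in the cell probe model is a decision tree: it either answers,
  or reads the cell at some address and continues depending on the contents in an arbitrary
  (not necessarily computable) way. Only the reads are charged.\<close>

datatype 'r probe_tree = Answer 'r | Probe nat "bool list \<Rightarrow> 'r probe_tree"

primrec probe_result :: "(nat \<Rightarrow> bool list) \<Rightarrow> 'r probe_tree \<Rightarrow> 'r" where
  "probe_result mem (Answer r) = r"
| "probe_result mem (Probe a k) = probe_result mem (k (mem a))"

primrec probe_count :: "(nat \<Rightarrow> bool list) \<Rightarrow> 'r probe_tree \<Rightarrow> nat" where
  "probe_count mem (Answer r) = 0"
| "probe_count mem (Probe a k) = Suc (probe_count mem (k (mem a)))"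

definition answers_within ::
  "nat \<Rightarrow> (nat \<Rightarrow> bool list) \<Rightarrow> 'r probe_tree \<Rightarrow> 'r \<Rightarrow> bool" where
  "answers_within t mem T r \<longleftrightarrow> probe_result mem T = r \<and> probe_count mem T \<le> t"

end

theory Submission
  imports Defs "HOL-Library.FuncSet" "HOL-Real_Asymp.Real_Asymp"
begin

text \<open>
  Let \<open>k = 2 ^ (4 * l)\<close> be of the order of \<open>log 2 m\<close>, and call the \<open>k\<close>-bit windows words. Split every
  element of \<open>S\<close> into leading bits, taken from a universe of size \<open>M\<close> between \<open>n * k ^ O(1)\<close> and twice
  that (or \<open>M = m\<close> if \<open>m\<close> is smaller), and \<open>s\<close> trailing bits. The trailing bits are kept in a plain array
  in sorted order; the set of the leading parts and the set of the positions where a new leading part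
  begins are kept in rank/select structures. As these universes exceed \<open>n\<close> by a factor
  that is at most polynomial in \<open>k\<close>, a tree of constant depth with block counts in its nodes
  does this with \<open>o(n)\<close> bits of redundancy: the leaves hold so few elements that the index of a subset
  fits into one word.

  This answers select, and it locates the run of elements with the same leading part as \<open>x\<close>. If \<open>e\<close>
  elements are not the first one of their run, then fixing only \<open>n - e\<close> leading parts saves a factor
  \<open>k ^ (c * e)\<close> in \<open>M choose n\<close>, with \<open>c\<close> as large as we like. This pays for \<open>O(log k)\<close> bits for each of
  those elements, including the \<open>O(log log m)\<close> bits of a hash function. They suffice for monotone hashing:
  cut every run into chunks of \<open>k\<close> elements; the longest common prefixes of the chunks are distinct, so
  storing for each element its offset in the chunk and the length of the prefix, and for each prefix the
  position of its chunk, yields a candidate for the position of \<open>x\<close>, which select verifies.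

  The perfect hash functions exist by counting: if every small set is good for a fraction \<open>1 / A\<close>
  of all functions, then \<open>A * ln N\<close> functions chosen greedily serve \<open>N\<close> sets.
\<close>

section \<open>Probing a bit memory\<close>

text \<open>\<open>probes k t F\<close>: the value of \<open>F\<close> on a bit memory is determined by at most \<open>t\<close> adaptively chosen
  windows of \<open>k\<close> consecutive bits. Working with functions of the memory instead of decision trees makes
  composition an ordinary \<open>let\<close>.\<close>

inductive probes :: "nat \<Rightarrow> nat \<Rightarrow> ((nat \<Rightarrow> bool) \<Rightarrow> 'r) \<Rightarrow> bool" for k where
  probes_const: "probes k t (\<lambda>_. r)"
| probes_step: "(\<And>c. probes k t (G c)) \<Longrightarrow> probes k (Suc t) (\<lambda>m. G (map m [a..<a + k]) m)"

lemma probes_Suc: "probes k t F \<Longrightarrow> probes k (Suc t) F"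
proof (induction rule: probes.induct)
  case (probes_const t r)
  show ?case by (rule probes.probes_const)
next
  case (probes_step t G a)
  show ?case using probes_step.IH by (rule probes.probes_step)
qed

lemma probes_mono:
  assumes "probes k t F" "t \<le> t'" shows "probes k t' F"
  using assms(2,1) by (induction rule: dec_induct) (auto intro: probes_Suc)

text \<open>Adaptivity enters here: the continuation \<open>G\<close> may choose its windows
  depending on the value of \<open>F\<close>.\<close>

lemma probes_bind:
  assumes "probes k t F" "\<And>r. probes k t' (G r)"
  shows "probes k (t + t') (\<lambda>m. G (F m) m)"
  using assms
proof (induction rule: probes.induct)
  case (probes_const t r)
  show ?case by (rule probes_mono[OF probes_const]) simp
next
  case (probes_step t H a)
  have "probes k (Suc (t + t')) (\<lambda>m. (\<lambda>c m. G (H c m) m) (map m [a..<a + k]) m)"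
    by (rule probes.probes_step) (use probes_step in auto)
  then show ?case by simp
qed

lemma probes_map: "probes k t F \<Longrightarrow> probes k t (\<lambda>m. g (F m))"
  using probes_bind[of k t F 0 "\<lambda>r _. g r"] by (auto intro: probes_const)

lemma probes_Let:
  assumes "probes k t F" "\<And>r. probes k t' (G r)"
  shows "probes k (t + t') (\<lambda>m. let v = F m in G v m)"
  using probes_bind[OF assms] by (simp add: Let_def)

lemma probes_if:
  assumes "probes k t F" "probes k t G"
  shows "probes k t (\<lambda>m. if c then F m else G m)"
  using assms by (cases c) auto

text \<open>The memory seen from address \<open>a\<close>; it allows every structure to be written
  as if it began at address 0.\<close>

definition shifted :: "nat \<Rightarrow> (nat \<Rightarrow> bool) \<Rightarrow> nat \<Rightarrow> bool" where
  "shifted a m = (\<lambda>i. m (a + i))"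

lemma map_shifted: "map (shifted b m) [a..<a + k] = map m [b + a..<b + a + k]"
  by (rule nth_equalityI) (auto simp: shifted_def ac_simps)

lemma probes_shifted: "probes k t F \<Longrightarrow> probes k t (\<lambda>m. F (shifted b m))"
proof (induction rule: probes.induct)
  case (probes_const t r)
  show ?case by (rule probes.probes_const)
next
  case (probes_step t G a)
  have "probes k (Suc t) (\<lambda>m. (\<lambda>c m. G c (shifted b m)) (map m [(b + a)..<(b + a) + k]) m)"
    by (rule probes.probes_step) (use probes_step in auto)
  then show ?case by (simp add: map_shifted)
qed

lemma probes_window: "probes k 1 (\<lambda>m. map m [a..<a + k])"
  using probes_step[of k 0 "\<lambda>c _. c" a] by (auto intro: probes_const)

lemma probes_windows: "probes k t (\<lambda>m. map m [a..<a + t * k])"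
proof (induction t arbitrary: a)
  case 0
  show ?case by (simp add: probes_const)
next
  case (Suc t)
  have "probes k (1 + t) (\<lambda>m. (\<lambda>r m. r @ map m [a + k..<(a + k) + t * k]) (map m [a..<a + k]) m)"
    by (rule probes_bind[OF probes_window]) (rule probes_map[OF Suc])
  moreover have "map m [a..<a + k] @ map m [a + k..<(a + k) + t * k] = map m [a..<a + Suc t * k]" for m :: "nat \<Rightarrow> bool"
    by (simp add: add.assoc upt_add_eq_append[symmetric] flip: map_append)
       (metis add.assoc le_add1 upt_add_eq_append)
  ultimately show ?case by simp
qed

lemma probes_bits:
  assumes "len \<le> t * k"
  shows "probes k t (\<lambda>m. map m [a..<a + len])"
proof -
  have "probes k t (\<lambda>m. take len (map m [a..<a + t * k]))"
    by (rule probes_map[OF probes_windows])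
  moreover have "take len (map m [a..<a + t * k]) = map m [a..<a + len]" for m :: "nat \<Rightarrow> bool"
    using assms by (simp add: take_map take_upt)
  ultimately show ?thesis by simp
qed

section \<open>Numbers and arrays as bit strings\<close>

definition read_nat :: "nat \<Rightarrow> nat \<Rightarrow> (nat \<Rightarrow> bool) \<Rightarrow> nat" where
  "read_nat a w m = horner_sum of_bool 2 (map m [a..<a + w])"

definition nat_bits :: "nat \<Rightarrow> nat \<Rightarrow> bool list" where
  "nat_bits w v = map (bit v) [0..<w]"

lemma length_nat_bits [simp]: "length (nat_bits w v) = w"
  by (simp add: nat_bits_def)

lemma probes_read_nat: "w \<le> t * k \<Longrightarrow> probes k t (read_nat a w)"
  unfolding read_nat_def by (rule probes_map[OF probes_bits])

text \<open>Structures are specified on all memories that contain their code, whatever the other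
  bits are. This is what allows codes to be concatenated and padded.\<close>

definition contains :: "(nat \<Rightarrow> bool) \<Rightarrow> nat \<Rightarrow> bool list \<Rightarrow> bool" where
  "contains m a xs \<longleftrightarrow> (\<forall>i < length xs. m (a + i) = xs ! i)"

lemma contains_append:
  "contains m a (xs @ ys) \<longleftrightarrow> contains m a xs \<and> contains m (a + length xs) ys"
proof
  assume L: "contains m a (xs @ ys)"
  have "m (a + length xs + i) = ys ! i" if "i < length ys" for i
    using L[unfolded contains_def, rule_format, of "length xs + i"] that by (simp add: nth_append ac_simps)
  moreover have "m (a + i) = xs ! i" if "i < length xs" for i
    using L[unfolded contains_def, rule_format, of i] that by (simp add: nth_append)
  ultimately show "contains m a xs \<and> contains m (a + length xs) ys" by (auto simp: contains_def)
next
  assume R: "contains m a xs \<and> contains m (a + length xs) ys"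
  show "contains m a (xs @ ys)" unfolding contains_def
  proof (intro allI impI)
    fix i assume i: "i < length (xs @ ys)"
    show "m (a + i) = (xs @ ys) ! i"
    proof (cases "i < length xs")
      case False
      then have "m (a + length xs + (i - length xs)) = ys ! (i - length xs)"
        using R[unfolded contains_def] i by (metis add_diff_inverse_nat length_append nat_add_left_cancel_less)
      then show ?thesis using False by (simp add: nth_append)
    qed (use R in \<open>auto simp: contains_def nth_append\<close>)
  qed
qed

lemma contains_shifted: "contains (shifted b m) a xs \<longleftrightarrow> contains m (b + a) xs"
  by (simp add: contains_def shifted_def ac_simps)

lemma contains_map: "contains m a xs \<Longrightarrow> map m [a..<a + length xs] = xs"
  by (rule nth_equalityI) (auto simp: contains_def)

lemma read_nat_contains:
  assumes "contains m a (nat_bits w v)" "v < 2 ^ w"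
  shows "read_nat a w m = v"
  using contains_map[OF assms(1)] assms(2)
  by (simp add: read_nat_def nat_bits_def horner_sum_bit_eq_take_bit take_bit_nat_eq_self)

lemma contains_concat:
  assumes "contains m a (concat (map g [0..<F]))" "i < F"
  shows "contains m (a + (\<Sum>j<i. length (g j))) (g i)"
  using assms
proof (induction F)
  case (Suc F)
  have len: "length (concat (map g [0..<F])) = (\<Sum>j<F. length (g j))" for F
    by (induction F) auto
  show ?case using Suc len by (auto simp: contains_append less_Suc_eq)
qed simp

definition array_bits :: "nat \<Rightarrow> nat \<Rightarrow> (nat \<Rightarrow> nat) \<Rightarrow> bool list" where
  "array_bits w N f = concat (map (\<lambda>i. nat_bits w (f i)) [0..<N])"

lemma length_array_bits [simp]: "length (array_bits w N f) = N * w"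
  by (simp add: array_bits_def length_concat o_def sum_list_triv)

lemma read_array:
  assumes "contains m a (array_bits w N f)" "i < N" "f i < 2 ^ w"
  shows "read_nat (a + i * w) w m = f i"
  using contains_concat[OF assms(1)[unfolded array_bits_def] assms(2)] assms(3)
  by (simp add: read_nat_contains)

lemma finite_code:
  assumes "finite A" "card A \<le> 2 ^ b"
  obtains enc :: "'a \<Rightarrow> bool list" and dec
  where "\<And>x. length (enc x) = b" "\<And>x. x \<in> A \<Longrightarrow> dec (enc x) = x"
proof -
  obtain f where f: "bij_betw f A {0..<card A}" using ex_bij_betw_finite_nat[OF assms(1)] by blast
  have lt: "f x < 2 ^ b" if "x \<in> A" for x
    using bij_betwE[OF f] that assms(2) by fastforce
  have "inv_into A f (horner_sum of_bool 2 (nat_bits b (f x))) = x" if "x \<in> A" for x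
    using lt[OF that] bij_betw_inv_into_left[OF f that]
    by (simp add: nat_bits_def horner_sum_bit_eq_take_bit take_bit_nat_eq_self)
  then show ?thesis
    using that[of "\<lambda>x. nat_bits b (f x)" "\<lambda>bs. inv_into A f (horner_sum of_bool 2 bs)"] by simp
qed

section \<open>From bit windows to cells\<close>

definition list_memory :: "bool list \<Rightarrow> nat \<Rightarrow> bool" where
  "list_memory bs i \<longleftrightarrow> i < length bs \<and> bs ! i"

lemma contains_list_memory: "contains (list_memory bs) 0 bs"
  by (simp add: contains_def list_memory_def)

primrec read_cells :: "nat \<Rightarrow> nat \<Rightarrow> (bool list \<Rightarrow> 'r probe_tree) \<Rightarrow> 'r probe_tree" where
  "read_cells b 0 G = G []"
| "read_cells b (Suc c) G = Probe b (\<lambda>xs. read_cells (Suc b) c (\<lambda>ys. G (xs @ ys)))"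

lemma read_cells:
  "probe_result (cell w bs) (read_cells b c G) =
     probe_result (cell w bs) (G (map (list_memory bs) [b * w..<b * w + c * w])) \<and>
   probe_count (cell w bs) (read_cells b c G) =
     c + probe_count (cell w bs) (G (map (list_memory bs) [b * w..<b * w + c * w]))"
proof (induction c arbitrary: b G)
  case (Suc c)
  have "cell w bs b @ map (list_memory bs) [Suc b * w..<Suc b * w + c * w]
      = map (list_memory bs) [b * w..<b * w + Suc c * w]"
  proof -
    have "cell w bs b = map (list_memory bs) [b * w..<b * w + w]"
      by (simp add: cell_def list_memory_def)
    moreover have "[b * w..<b * w + w] @ [b * w + w..<b * w + w + c * w] = [b * w..<b * w + w + c * w]"
      by (metis le_add1 upt_add_eq_append)
    ultimately show ?thesis by (simp add: add.assoc add.commute[of w] flip: map_append)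
  qed
  then show ?case using Suc[of "Suc b"] by simp
qed simp

text \<open>A window of at most \<open>C * w\<close> bits that begins inside a cell is covered by
  \<open>C + 1\<close> consecutive cells. The tree is chosen before \<open>bs\<close>, so it depends
  on the query alone.\<close>

lemma probe_tree_of_probes:
  assumes "probes k t F" "0 < w" "k \<le> C * w"
  shows "\<exists>T. \<forall>bs. answers_within (t * Suc C) (cell w bs) T (F (list_memory bs))"
  using assms(1)
proof (induction rule: probes.induct)
  case (probes_const t r)
  show ?case by (rule exI[of _ "Answer r"]) (simp add: answers_within_def)
next
  case (probes_step t G a)
  then obtain T where T: "\<And>c bs. answers_within (t * Suc C) (cell w bs) (T c) (G c (list_memory bs))"
    by metis
  let ?T = "read_cells (a div w) (Suc C) (\<lambda>xs. T (take k (drop (a mod w) xs)))"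
  have "take k (drop (a mod w) (map f [a div w * w..<a div w * w + Suc C * w])) = map f [a..<a + k]"
    for f :: "nat \<Rightarrow> bool"
  proof -
    have "a + k \<le> a div w * w + Suc C * w"
      using assms(2,3) mod_less_divisor[of w a] div_mult_mod_eq[of a w] unfolding mult_Suc by linarith
    then show ?thesis by (simp add: take_map drop_map drop_upt take_upt)
  qed
  then show ?case
    using T by (intro exI[of _ ?T]) (auto simp: answers_within_def read_cells simp del: read_cells.simps)
qed

section \<open>Perfect hashing and retrieval\<close>

text \<open>Some \<open>g\<close> is good for a fraction of at least \<open>1 / A\<close> of the
  remaining \<open>x\<close>, so each round multiplies their number by at most
  \<open>1 - 1 / A\<close>, which is at most \<open>exp (- 1 / A)\<close>. After \<open>N\<close>
  rounds fewer than one is left.\<close>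

lemma greedy_cover:
  fixes good :: "'g \<Rightarrow> 'x \<Rightarrow> bool" and A :: real
  assumes "finite G" "G \<noteq> {}" "1 \<le> A"
    and "finite XX" "\<And>x. x \<in> XX \<Longrightarrow> real (card G) \<le> A * real (card {g \<in> G. good g x})"
    and "real (card XX) < exp (real N / A)"
  obtains gs where "length gs = N" "set gs \<subseteq> G" "\<And>x. x \<in> XX \<Longrightarrow> \<exists>i<N. good (gs ! i) x"
proof -
  have "\<exists>gs. length gs = N \<and> set gs \<subseteq> G \<and> (\<forall>x\<in>XX. \<exists>i<N. good (gs ! i) x)"
    using assms(4-6)
  proof (induction N arbitrary: XX)
    case 0
    then show ?case by simp
  next
    case (Suc N)
    have "(\<Sum>x\<in>XX. real (card G) / A) \<le> (\<Sum>x\<in>XX. real (card {g \<in> G. good g x}))"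
      using Suc.prems assms(3) by (intro sum_mono) (auto simp: field_simps)
    also have "\<dots> = (\<Sum>x\<in>XX. \<Sum>g\<in>G. if good g x then 1 else 0)"
      using assms(1) by (simp add: sum.If_cases Int_def conj_commute)
    also have "\<dots> = (\<Sum>g\<in>G. \<Sum>x\<in>XX. if good g x then 1 else 0)"
      by (rule sum.swap)
    also have "\<dots> = (\<Sum>g\<in>G. real (card {x \<in> XX. good g x}))"
      using Suc.prems(1) by (simp add: sum.If_cases Int_def conj_commute)
    finally have le: "(\<Sum>g\<in>G. real (card XX) / A) \<le> (\<Sum>g\<in>G. real (card {x \<in> XX. good g x}))"
      by (simp add: mult.commute)
    \<comment> \<open>Averaging over \<open>G\<close> after the double count.\<close>
    obtain g where g: "g \<in> G" "real (card XX) / A \<le> real (card {x \<in> XX. good g x})"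
      using sum_strict_mono[OF assms(1,2), of "\<lambda>g. real (card {x \<in> XX. good g x})" "\<lambda>_. real (card XX) / A"] le
      by (meson not_le)
    let ?R = "{x \<in> XX. \<not> good g x}"
    have "XX = {x \<in> XX. good g x} \<union> ?R" by blast
    then have "card XX = card {x \<in> XX. good g x} + card ?R"
      using Suc.prems(1) by (subst card_Un_disjoint[symmetric]) auto
    then have "real (card ?R) \<le> real (card XX) * (1 - 1 / A)"
      using g(2) by (simp add: algebra_simps add_divide_distrib)
    also have "\<dots> \<le> real (card XX) * exp (- 1 / A)"
      using exp_ge_add_one_self[of "- 1 / A"] by (intro mult_left_mono) auto
    also have "\<dots> < exp (real (Suc N) / A) * exp (- 1 / A)"
      using Suc.prems(3) by simp
    also have "\<dots> = exp (real N / A)" by (simp add: add_divide_distrib flip: exp_add)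
    finally obtain gs where gs: "length gs = N" "set gs \<subseteq> G" "\<forall>x\<in>?R. \<exists>i<N. good (gs ! i) x"
      using Suc.IH[of ?R] Suc.prems by auto
    have "\<exists>i<Suc N. good ((g # gs) ! i) x" if x: "x \<in> XX" for x
    proof (cases "good g x")
      case False
      then obtain i where "i < N" "good (gs ! i) x" using gs x by auto
      then show ?thesis by (intro exI[of _ "Suc i"]) auto
    qed auto
    then show ?case using gs(1,2) g(1) by (intro exI[of _ "g # gs"]) auto
  qed
  then show ?thesis using that by blast
qed

lemma card_small_subsets:
  assumes "finite U"
  shows "finite {X. X \<subseteq> U \<and> card X \<le> e}" "card {X. X \<subseteq> U \<and> card X \<le> e} \<le> (card U + 1) ^ e"
proof -
  let ?L = "{xs. set xs \<subseteq> insert None (Some ` U) \<and> length xs = e}"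
  show "finite {X. X \<subseteq> U \<and> card X \<le> e}"
    by (rule finite_subset[of _ "Pow U"]) (use assms in auto)
  have "{X. X \<subseteq> U \<and> card X \<le> e} \<subseteq> (\<lambda>xs. {x. Some x \<in> set xs}) ` ?L"
  proof
    fix X assume X: "X \<in> {X. X \<subseteq> U \<and> card X \<le> e}"
    then have "finite X" using assms finite_subset by blast
    then obtain ys where ys: "set ys = X" "length ys = card X"
      by (metis finite_distinct_list distinct_card)
    let ?xs = "map Some ys @ replicate (e - card X) None"
    have "?xs \<in> ?L" using ys X by auto
    moreover have "X = {x. Some x \<in> set ?xs}" using ys by auto
    ultimately show "X \<in> (\<lambda>xs. {x. Some x \<in> set xs}) ` ?L" by blast
  qed
  moreover have "finite ?L" using assms by (intro finite_lists_length_eq) auto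
  ultimately have "card {X. X \<subseteq> U \<and> card X \<le> e} \<le> card ?L"
    by (meson surj_card_le)
  also have "\<dots> = card (insert None (Some ` U)) ^ e"
    using assms by (intro card_lists_length_eq) auto
  also have "card (insert None (Some ` U)) = card U + 1"
    using assms by (subst card_insert_disjoint) (auto simp: card_image)
  finally show "card {X. X \<subseteq> U \<and> card X \<le> e} \<le> (card U + 1) ^ e" .
qed

section \<open>Fractions of injective and of balanced functions\<close>

lemma power_self_le_fact: "n ^ n \<le> 3 ^ n * (fact n :: nat)"
proof (induction n)
  case (Suc n)
  show ?case
  proof (cases "n = 0")
    case False
    have "(1 + 1 / real n) ^ n \<le> exp (1 / real n) ^ n"
      by (intro power_mono exp_ge_add_one_self) auto
    also have "\<dots> = exp 1" using False by (simp flip: exp_of_nat_mult)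
    also have "\<dots> \<le> 3" by (rule exp_le)
    finally have "(1 + 1 / real n) ^ n * real n ^ n \<le> 3 * real n ^ n" by (intro mult_right_mono) auto
    then have "real (Suc n ^ n) \<le> real (3 * n ^ n)"
      using False by (simp add: distrib_right add.commute flip: power_mult_distrib)
    then have "Suc n ^ n \<le> 3 * n ^ n" by linarith
    also have "\<dots> \<le> 3 * (3 ^ n * fact n)" using Suc by simp
    finally have "Suc n * Suc n ^ n \<le> Suc n * (3 * (3 ^ n * fact n))" by (rule mult_le_mono2)
    then show ?thesis by (simp add: algebra_simps)
  qed simp
qed simp

text \<open>For \<open>l = card X\<close> the fraction of injective functions is
  \<open>c * (c - 1) * ... * (c - l + 1) / c ^ l\<close>. It is smallest for \<open>l = c\<close>,
  where it equals \<open>fact c / c ^ c\<close>, at least \<open>1 / 3 ^ c\<close>.\<close>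

lemma injective_fraction:
  assumes "finite U" "X \<subseteq> U" "card X \<le> c" "0 < c"
  shows "real (card (U \<rightarrow>\<^sub>E {..<c})) \<le> 3 ^ c * real (card {f \<in> U \<rightarrow>\<^sub>E {..<c}. inj_on f X})"
proof -
  let ?l = "card X"
  let ?p = "\<Prod>i\<in>{0..<?l}. c - i"
  have "fact c = (\<Prod>i\<in>{0..<c}. c - i)" by (simp add: fact_prod_rev)
  also have "\<dots> = ?p * (\<Prod>i\<in>{?l..<c}. c - i)"
    using assms(3) by (subst prod.atLeastLessThan_concat) auto
  also have "\<dots> \<le> ?p * (\<Prod>i\<in>{?l..<c}. c)"
    by (intro mult_le_mono2 prod_mono) auto
  finally have f: "fact c \<le> ?p * c ^ (c - ?l)" by simp
  have "c ^ ?l * c ^ (c - ?l) = c ^ c" using assms(3) by (simp flip: power_add)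
  also have "\<dots> \<le> 3 ^ c * fact c" by (rule power_self_le_fact)
  also have "\<dots> \<le> 3 ^ c * ?p * c ^ (c - ?l)" using f by (simp add: mult.assoc)
  finally have l: "c ^ ?l \<le> 3 ^ c * ?p" using assms(4) by simp
  have "c ^ card U = c ^ ?l * c ^ (card U - ?l)"
    using card_mono[OF assms(1,2)] by (simp flip: power_add)
  also have "\<dots> \<le> 3 ^ c * ?p * c ^ (card U - ?l)" using l by simp
  also have "\<dots> = 3 ^ c * card {f \<in> U \<rightarrow>\<^sub>E {..<c}. inj_on f X}"
    using card_inj_on_subset_funcset[OF assms(1) _ assms(2), of "{..<c}"] by simp
  finally have "card (U \<rightarrow>\<^sub>E {..<c}) \<le> 3 ^ c * card {f \<in> U \<rightarrow>\<^sub>E {..<c}. inj_on f X}"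
    using assms(1) by (simp add: card_funcsetE)
  then have "real (card (U \<rightarrow>\<^sub>E {..<c})) \<le> real (3 ^ c * card {f \<in> U \<rightarrow>\<^sub>E {..<c}. inj_on f X})"
    by (rule of_nat_mono)
  then show ?thesis by simp
qed

text \<open>Union bound over a bucket \<open>b\<close> and a set of \<open>6 * a\<close> elements of
  \<open>X\<close> that all go to \<open>b\<close>. As \<open>(2 * a) ^ (6 * a)\<close> is at most
  \<open>fact (6 * a)\<close> and \<open>card X\<close> is at most \<open>\<beta> * a\<close>, the
  bad fraction is at most \<open>\<beta> / 2 ^ (6 * a)\<close>, hence at most one half.\<close>

lemma balanced_fraction:
  fixes e \<beta> a :: nat
  assumes "finite U" "X \<subseteq> U" "card X \<le> e" "e \<le> \<beta> * a" "0 < a" "0 < \<beta>" "2 * \<beta> \<le> 2 ^ (6 * a)"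
  shows "real (card (U \<rightarrow>\<^sub>E {..<\<beta>})) \<le>
    2 * real (card {f \<in> U \<rightarrow>\<^sub>E {..<\<beta>}. \<forall>b<\<beta>. card {x \<in> X. f x = b} < 6 * a})"
proof -
  let ?c = "6 * a"
  let ?F = "U \<rightarrow>\<^sub>E {..<\<beta>}"
  let ?good = "{f \<in> ?F. \<forall>b<\<beta>. card {x \<in> X. f x = b} < ?c}"
  let ?bad = "{f \<in> ?F. \<not> (\<forall>b<\<beta>. card {x \<in> X. f x = b} < ?c)}"
  let ?YY = "{Y. Y \<subseteq> X \<and> card Y = ?c}"
  have fX: "finite X" using assms finite_subset by blast
  have fF: "finite ?F" using assms(1) by (intro finite_PiE) auto
  have fYY: "finite ?YY" using fX by simp
  have card_const: "card {f \<in> ?F. \<forall>y\<in>Y. f y = b} \<le> \<beta> ^ (card U - ?c)" if Y: "Y \<in> ?YY" "b < \<beta>" for Y b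
  proof -
    have YU: "Y \<subseteq> U" using Y assms(2) by blast
    have "{f \<in> ?F. \<forall>y\<in>Y. f y = b} \<subseteq> PiE U (\<lambda>x. if x \<in> Y then {b} else {..<\<beta>})"
      by (auto simp: PiE_iff extensional_def)
    then have "card {f \<in> ?F. \<forall>y\<in>Y. f y = b} \<le> card (PiE U (\<lambda>x. if x \<in> Y then {b} else {..<\<beta>}))"
      using assms(1) by (intro card_mono finite_PiE) auto
    also have "\<dots> = (\<Prod>x\<in>U. if x \<in> Y then 1 else \<beta>)"
      using assms(1) by (subst card_PiE) (auto intro!: prod.cong)
    also have "\<dots> = \<beta> ^ card (U - Y)"
      using assms(1) by (subst prod.If_cases) (auto simp: Diff_eq)
    also have "card (U - Y) = card U - ?c"
      using Y YU finite_subset[OF YU assms(1)] by (subst card_Diff_subset) auto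
    finally show ?thesis .
  qed
  have "?bad \<subseteq> (\<Union>Y\<in>?YY. \<Union>b<\<beta>. {f \<in> ?F. \<forall>y\<in>Y. f y = b})"
  proof
    fix f assume f: "f \<in> ?bad"
    then obtain b where b: "b < \<beta>" "?c \<le> card {x \<in> X. f x = b}" by (auto simp: not_less)
    then obtain Y where "Y \<subseteq> {x \<in> X. f x = b}" "card Y = ?c"
      by (meson obtain_subset_with_card_n)
    then show "f \<in> (\<Union>Y\<in>?YY. \<Union>b<\<beta>. {f \<in> ?F. \<forall>y\<in>Y. f y = b})"
      using f b(1) by blast
  qed
  then have "card ?bad \<le> card (\<Union>Y\<in>?YY. \<Union>b<\<beta>. {f \<in> ?F. \<forall>y\<in>Y. f y = b})"
    by (intro card_mono) (use fYY fF in auto)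
  also have "\<dots> \<le> (\<Sum>Y\<in>?YY. \<Sum>b<\<beta>. card {f \<in> ?F. \<forall>y\<in>Y. f y = b})"
    by (rule order_trans[OF card_UN_le[OF fYY] sum_mono[OF card_UN_le[OF finite_lessThan]]])
  also have "\<dots> \<le> (\<Sum>Y\<in>?YY. \<Sum>b<\<beta>. \<beta> ^ (card U - ?c))"
    by (intro sum_mono card_const) auto
  also have "\<dots> = (card X choose ?c) * \<beta> * \<beta> ^ (card U - ?c)"
    using n_subsets[OF fX, of ?c] by simp
  finally have bad: "card ?bad \<le> (card X choose ?c) * \<beta> * \<beta> ^ (card U - ?c)" .
  have two_bad: "2 * card ?bad \<le> card ?F"
  proof (cases "?c \<le> card X")
    case False
    then show ?thesis using bad by (simp add: binomial_eq_0)
  next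
    case True
    then have cU: "?c \<le> card U" using card_mono[OF assms(1,2)] by simp
    have "3 ^ ?c * (2 * a) ^ ?c \<le> 3 ^ ?c * fact ?c"
      using power_self_le_fact[of ?c] unfolding power_mult_distrib[symmetric] by simp
    then have "(2 * a) ^ ?c \<le> fact ?c" by simp
    then have "(card X choose ?c) * (2 * a) ^ ?c \<le> (card X choose ?c) * fact ?c"
      by (rule mult_le_mono2)
    also have "\<dots> \<le> card X ^ ?c" by (rule binomial_fact_pow)
    also have "\<dots> \<le> (\<beta> * a) ^ ?c" using assms(3,4) by (intro power_mono) auto
    finally have "(card X choose ?c) * 2 ^ ?c * a ^ ?c \<le> \<beta> ^ ?c * a ^ ?c"
      by (simp only: power_mult_distrib mult.assoc)
    then have "(card X choose ?c) * 2 ^ ?c \<le> \<beta> ^ ?c" using assms(5) by simp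
    then have "(card X choose ?c) * (2 * \<beta>) \<le> \<beta> ^ ?c"
      using assms(7) by (meson mult_le_mono2 order_trans)
    then have "(card X choose ?c) * (2 * \<beta>) * \<beta> ^ (card U - ?c) \<le> \<beta> ^ ?c * \<beta> ^ (card U - ?c)"
      by (rule mult_le_mono1)
    also have "\<dots> = card ?F" using cU assms(1) by (simp add: card_funcsetE flip: power_add)
    finally show ?thesis using bad by (simp add: ac_simps)
  qed
  have "?F = ?good \<union> ?bad" by blast
  then have "card ?F = card ?good + card ?bad"
    using fF by (subst card_Un_disjoint[symmetric]) auto
  then have "card ?F \<le> 2 * card ?good" using two_bad by linarith
  then show ?thesis by linarith
qed

text \<open>At most \<open>2 ^ (3 * k * e)\<close> sets have to be served, so a list whose length is
  of the order of \<open>A * k * e\<close> suffices, and naming one of its members is cheap.\<close>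

lemma cover_small_subsets:
  fixes good :: "('a \<Rightarrow> nat) \<Rightarrow> 'a set \<Rightarrow> bool" and A :: real
  assumes "finite U" "card U \<le> 2 ^ (2 * k)" "0 < k" "0 < c" "1 \<le> A"
    and "\<And>X. X \<subseteq> U \<Longrightarrow> card X \<le> e \<Longrightarrow>
      real (card (U \<rightarrow>\<^sub>E {..<c})) \<le> A * real (card {f \<in> U \<rightarrow>\<^sub>E {..<c}. good f X})"
    and "A * real (3 * k * e) < real N"
  obtains gs where "length gs = N" "set gs \<subseteq> U \<rightarrow>\<^sub>E {..<c}" "\<And>X. X \<subseteq> U \<Longrightarrow> card X \<le> e \<Longrightarrow> \<exists>i<N. good (gs ! i) X"
proof -
  let ?XX = "{X. X \<subseteq> U \<and> card X \<le> e}"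
  have "(1::nat) \<le> 2 ^ (2 * k)" by (rule one_le_power) simp
  then have "card U + 1 \<le> 2 ^ (2 * k) * 2 ^ 1" using assms(2) unfolding power_one_right by linarith
  also have "\<dots> \<le> 2 ^ (2 * k) * 2 ^ k"
    using assms(3) by (intro mult_le_mono2 power_increasing) auto
  also have "\<dots> = (2::nat) ^ (3 * k)" by (simp flip: power_add)
  finally have "card U + 1 \<le> (2::nat) ^ (3 * k)" .
  then have "(card U + 1) ^ e \<le> (2 ^ (3 * k)) ^ e" by (rule power_mono) simp
  then have "card ?XX \<le> 2 ^ (3 * k * e)"
    using card_small_subsets(2)[OF assms(1), of e] by (simp add: power_mult)
  then have "real (card ?XX) \<le> real (2 ^ (3 * k * e))" by (rule of_nat_mono)
  also have "\<dots> \<le> exp 1 ^ (3 * k * e)"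
    using exp_ge_add_one_self[of 1] by (simp add: power_mono)
  also have "\<dots> = exp (real (3 * k * e))" by (simp flip: exp_of_nat_mult)
  also have "\<dots> < exp (real N / A)" using assms(5,7) by (simp add: field_simps)
  finally have lt: "real (card ?XX) < exp (real N / A)" .
  have "(U \<rightarrow>\<^sub>E {..<c}) \<noteq> {}" using assms(4) by (auto simp: PiE_eq_empty_iff)
  moreover have "finite (U \<rightarrow>\<^sub>E {..<c})" using assms(1) by (intro finite_PiE) auto
  ultimately obtain gs where gs: "length gs = N" "set gs \<subseteq> U \<rightarrow>\<^sub>E {..<c}"
    "\<And>X. X \<in> ?XX \<Longrightarrow> \<exists>i<N. good (gs ! i) X"
    using greedy_cover[of "U \<rightarrow>\<^sub>E {..<c}" A ?XX good N, OF _ _ assms(5) card_small_subsets(1)[OF assms(1)] _ lt]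
      assms(6) by (metis (no_types, lifting) mem_Collect_eq)
  show ?thesis by (rule that[OF gs(1,2)]) (use gs(3) in blast)
qed

text \<open>Two levels. One function from the list \<open>gs\<close> spreads \<open>X\<close> over
  \<open>\<beta>\<close> buckets with fewer than \<open>6 * a\<close> elements each; for every
  bucket a function from the list \<open>hs\<close> is injective on it. Only indices into the two
  lists are stored, \<open>O(l)\<close> bits per element in total, and each index is read with
  \<open>O(1)\<close> probes.\<close>

lemma perfect_hash:
  fixes U :: "'a set" and k l e :: nat
  assumes "finite U" "card U \<le> 2 ^ (2 * k)" "k = 2 ^ (4 * l)" "0 < l" "0 < e" "e \<le> 2 ^ k"
  obtains enc :: "'a set \<Rightarrow> bool list" and H b pos
  where "b \<le> 60 * e * l" "\<And>x. probes k 32 (H x)" "\<And>X. length (enc X) = b"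
    "\<And>X. X \<subseteq> U \<Longrightarrow> card X \<le> e \<Longrightarrow> inj_on (pos X) X"
    "\<And>X x. X \<subseteq> U \<Longrightarrow> card X \<le> e \<Longrightarrow> x \<in> X \<Longrightarrow> pos X x < 12 * e"
    "\<And>X x m. X \<subseteq> U \<Longrightarrow> card X \<le> e \<Longrightarrow> x \<in> X \<Longrightarrow> contains m 0 (enc X) \<Longrightarrow> H x m = pos X x"
proof -
  \<comment> \<open>Buckets of size \<open>O(k)\<close> keep the index of a second-level function
    within \<open>O(k)\<close> bits. For \<open>e \<le> k\<close> the minimum leads to a single
    bucket.\<close>
  define a where "a = min k e"
  define \<beta> where "\<beta> = (e + a - 1) div a"
  define c where "c = 6 * a"
  \<comment> \<open>The lists have lengths \<open>2 ^ w0 = 8 * k * 2 ^ a\<close> and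
    \<open>2 ^ w2 = 4 ^ c * (4 * k * 2 ^ c)\<close>, which exceed the \<open>6 * k * e\<close> and
    \<open>3 ^ c * 3 * k * c\<close> functions that the covering argument asks for.\<close>
  define w0 where "w0 = 4 * l + 3 + a"
  define w2 where "w2 = 3 * c + 4 * l + 2"
  have k0: "0 < k" using assms by simp
  have a0: "0 < a" using k0 assms by (simp add: a_def)
  have c0: "0 < c" using a0 by (simp add: c_def)
  have ak: "a \<le> k" and ae: "a \<le> e" by (auto simp: a_def)
  have eba: "e \<le> \<beta> * a"
  proof -
    have "e + a - 1 = \<beta> * a + (e + a - 1) mod a" unfolding \<beta>_def by simp
    moreover have "(e + a - 1) mod a < a" using a0 by simp
    ultimately show ?thesis by linarith
  qed
  have ba: "\<beta> * a \<le> 2 * e"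
  proof -
    have "\<beta> * a \<le> e + a - 1" unfolding \<beta>_def by simp
    then show ?thesis using ae by linarith
  qed
  have b0: "0 < \<beta>" using eba assms(5) by (cases "\<beta> = 0") auto
  have b_le: "\<beta> \<le> 2 * e" using ba a0 by (metis le_trans mult.right_neutral mult_le_mono2 Suc_leI One_nat_def)
  have b2: "2 * \<beta> \<le> 2 ^ (6 * a)"
  proof (cases "e \<le> k")
    case True
    then have "\<beta> * e \<le> e + e - 1" unfolding \<beta>_def a_def by (simp add: min_def)
    then have "\<beta> * e < 2 * e" using assms(5) by linarith
    then have "2 * \<beta> \<le> 2 ^ 1" by simp
    also have "\<dots> \<le> (2::nat) ^ (6 * a)" using a0 by (intro power_increasing) auto
    finally show ?thesis .
  next
    case False
    then have "a = k" by (simp add: a_def)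
    have "2 * \<beta> \<le> 2 ^ (k + 2)" using b_le assms(6) by simp
    also have "\<dots> \<le> 2 ^ (6 * a)" using k0 \<open>a = k\<close> by (intro power_increasing) auto
    finally show ?thesis .
  qed
  have e2a: "e \<le> 2 ^ a" using assms(6) less_exp[of e] by (auto simp: a_def min_def)
  obtain gs where gs: "length gs = 2 ^ w0" "set gs \<subseteq> U \<rightarrow>\<^sub>E {..<\<beta>}"
    "\<And>X. X \<subseteq> U \<Longrightarrow> card X \<le> e \<Longrightarrow> \<exists>i<2 ^ w0. \<forall>b<\<beta>. card {x \<in> X. (gs ! i) x = b} < 6 * a"
  proof (rule cover_small_subsets[where N = "2 ^ w0" and A = 2 and c = \<beta> and e = e and
        good = "\<lambda>f X. \<forall>b<\<beta>. card {x \<in> X. f x = b} < 6 * a", OF assms(1,2) k0 b0])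
    have "k * e \<le> 2 ^ (4 * l) * 2 ^ a" using assms(3) e2a by simp
    moreover have "0 < k * e" using k0 assms(5) by simp
    ultimately have "6 * (k * e) < 8 * (2 ^ (4 * l) * 2 ^ a)" by linarith
    also have "\<dots> = 2 ^ w0" by (simp add: w0_def power_add)
    finally have "real (6 * (k * e)) < real (2 ^ w0)" by (rule of_nat_less_iff[THEN iffD2])
    then show "2 * real (3 * k * e) < real (2 ^ w0)" by simp
  qed (use balanced_fraction[OF assms(1) _ _ eba a0 b0 b2] in auto)
  obtain hs where hs: "length hs = 2 ^ w2" "set hs \<subseteq> U \<rightarrow>\<^sub>E {..<c}"
    "\<And>X. X \<subseteq> U \<Longrightarrow> card X \<le> c \<Longrightarrow> \<exists>i<2 ^ w2. inj_on (hs ! i) X"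
  proof (rule cover_small_subsets[where N = "2 ^ w2" and A = "3 ^ c" and c = c and e = c and
        good = "\<lambda>f X. inj_on f X", OF assms(1,2) k0 c0])
    have "(3::nat) ^ c * (3 * k * c) \<le> 4 ^ c * (3 * k * 2 ^ c)"
      using less_exp[of c] by (intro mult_mono power_mono) auto
    also have "\<dots> < 4 ^ c * (4 * k * 2 ^ c)" using k0 by simp
    also have "\<dots> = 2 ^ w2"
      by (simp add: w2_def power_add power_mult assms(3) flip: power_mult_distrib)
    finally have "real (3 ^ c * (3 * k * c)) < real (2 ^ w2)" by (rule of_nat_less_iff[THEN iffD2])
    then show "3 ^ c * real (3 * k * c) < real (2 ^ w2)" by simp
  qed (use injective_fraction[OF assms(1) _ _ c0] in auto)
  define i1 where "i1 X = (SOME i. i < 2 ^ w0 \<and> (\<forall>b<\<beta>. card {x \<in> X. (gs ! i) x = b} < 6 * a))" for X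
  define i2 where "i2 X b = (SOME i. i < 2 ^ w2 \<and> inj_on (hs ! i) {x \<in> X. (gs ! i1 X) x = b})" for X b
  define enc where "enc X = nat_bits w0 (i1 X) @ array_bits w2 \<beta> (i2 X)" for X
  define H where "H x m = (let i = read_nat 0 w0 m in
      (let j = read_nat (w0 + (gs ! i) x * w2) w2 m in (gs ! i) x * c + (hs ! j) x))" for x m
  define pos where "pos X x = (gs ! i1 X) x * c + (hs ! i2 X ((gs ! i1 X) x)) x" for X x
  have l4: "4 * l \<le> k" "3 \<le> k"
  proof -
    show "4 * l \<le> k" using less_exp[of "4 * l"] assms(3) by simp
    have "(2::nat) ^ 4 \<le> 2 ^ (4 * l)" using assms(4) by (intro power_increasing) auto
    then show "3 \<le> k" using assms(3) by simp
  qed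
  show ?thesis
  proof (rule that)
    have "w0 \<le> 8 * e * l"
    proof -
      have "l \<le> e * l" "1 \<le> e * l" "e \<le> e * l" using assms(4,5) by auto
      then show ?thesis using ae unfolding w0_def by linarith
    qed
    moreover have "\<beta> * w2 \<le> 48 * e * l"
    proof -
      have "\<beta> * w2 = 18 * (\<beta> * a) + \<beta> * (4 * l + 2)" by (simp add: w2_def c_def algebra_simps)
      also have "\<dots> \<le> 18 * (2 * e) + (2 * e) * (6 * l)"
        using assms(4) by (intro add_mono[OF mult_le_mono2[OF ba] mult_le_mono[OF b_le]]) simp
      also have "\<dots> \<le> 48 * e * l" using assms(4) by (simp add: algebra_simps)
      finally show ?thesis .
    qed
    ultimately show "w0 + \<beta> * w2 \<le> 60 * e * l" by simp
    show "length (enc X) = w0 + \<beta> * w2" for X by (simp add: enc_def)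
    show "probes k 32 (H x)" for x
    proof -
      have "w0 \<le> 3 * k" "w2 \<le> 20 * k" using l4 ak by (simp_all add: w0_def w2_def c_def)
      then have "probes k (3 + (20 + 0)) (H x)" unfolding H_def
        by (intro probes_Let probes_read_nat probes_const)
      then show ?thesis by (rule probes_mono) simp
    qed
    fix X assume X: "X \<subseteq> U" "card X \<le> e"
    have i1: "i1 X < 2 ^ w0" "\<And>b. b < \<beta> \<Longrightarrow> card {x \<in> X. (gs ! i1 X) x = b} < 6 * a"
      using someI_ex[OF gs(3)[OF X]] unfolding i1_def by auto
    have i2: "i2 X b < 2 ^ w2" "inj_on (hs ! i2 X b) {x \<in> X. (gs ! i1 X) x = b}" if "b < \<beta>" for b
    proof -
      have "\<exists>i<2 ^ w2. inj_on (hs ! i) {x \<in> X. (gs ! i1 X) x = b}"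
        using i1(2)[OF that] X by (intro hs(3)) (auto simp: c_def)
      from someI_ex[OF this] show "i2 X b < 2 ^ w2" "inj_on (hs ! i2 X b) {x \<in> X. (gs ! i1 X) x = b}"
        unfolding i2_def by auto
    qed
    have g: "(gs ! i1 X) x < \<beta>" if "x \<in> X" for x
      using gs(1,2) i1(1) X(1) that nth_mem[of "i1 X" gs] by (auto simp: PiE_iff subset_iff)
    have h: "(hs ! j) x < c" if "x \<in> X" "j < 2 ^ w2" for x j
      using hs(1,2) X(1) that nth_mem[of j hs] by (auto simp: PiE_iff subset_iff)
    have small: "(hs ! i2 X ((gs ! i1 X) x)) x < c" if "x \<in> X" for x
      using h[OF that] i2(1)[OF g[OF that]] by blast
    have pos: "pos X x div c = (gs ! i1 X) x" "pos X x mod c = (hs ! i2 X ((gs ! i1 X) x)) x"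
      if "x \<in> X" for x
      using small[OF that] by (auto simp: pos_def)
    show "inj_on (pos X) X"
    proof (rule inj_onI)
      fix x y assume xy: "x \<in> X" "y \<in> X" "pos X x = pos X y"
      then have eq: "(gs ! i1 X) x = (gs ! i1 X) y"
        "(hs ! i2 X ((gs ! i1 X) x)) x = (hs ! i2 X ((gs ! i1 X) y)) y"
        using pos[OF xy(1)] pos[OF xy(2)] by auto
      show "x = y" using i2(2)[OF g[OF xy(2)]] eq xy by (auto dest: inj_onD)
    qed
    fix x assume x: "x \<in> X"
    show "pos X x < 12 * e"
    proof -
      have "pos X x < (gs ! i1 X) x * c + c" using small[OF x] by (simp add: pos_def)
      also have "\<dots> \<le> \<beta> * c" using g[OF x]
        by (metis Suc_leI add.commute mult_Suc mult_le_mono1)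
      also have "\<dots> \<le> 12 * e" using ba by (simp add: c_def)
      finally show ?thesis .
    qed
    fix m assume "contains m 0 (enc X)"
    then have con: "contains m 0 (nat_bits w0 (i1 X))" "contains m w0 (array_bits w2 \<beta> (i2 X))"
      by (auto simp: enc_def contains_append)
    show "H x m = pos X x"
      unfolding H_def pos_def
      using read_nat_contains[OF con(1) i1(1)] read_array[OF con(2) g[OF x] i2(1)[OF g[OF x]]]
      by (simp add: Let_def)
  qed
qed

section \<open>Retrieval of values for the keys of a set\<close>

definition retrieval_by :: "nat \<Rightarrow> nat \<Rightarrow> 'a set \<Rightarrow> nat \<Rightarrow> nat \<Rightarrow> nat \<Rightarrow>
    ('a set \<Rightarrow> ('a \<Rightarrow> nat) \<Rightarrow> bool list) \<Rightarrow> ('a \<Rightarrow> (nat \<Rightarrow> bool) \<Rightarrow> nat) \<Rightarrow> bool" where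
  "retrieval_by k t U e w b enc get \<longleftrightarrow> (\<forall>x. probes k t (get x)) \<and>
     (\<forall>X v. X \<subseteq> U \<longrightarrow> card X \<le> e \<longrightarrow> (\<forall>x\<in>X. v x < 2 ^ w) \<longrightarrow> length (enc X v) = b \<and>
       (\<forall>m. contains m 0 (enc X v) \<longrightarrow> (\<forall>x\<in>X. get x m = v x)))"

definition retrieval :: "nat \<Rightarrow> nat \<Rightarrow> 'a set \<Rightarrow> nat \<Rightarrow> nat \<Rightarrow> nat \<Rightarrow> bool" where
  "retrieval k t U e w b \<longleftrightarrow> (\<exists>enc get. retrieval_by k t U e w b enc get)"

lemma retrieval_byD:
  assumes "retrieval_by k t U e w b enc get"
  shows "probes k t (get x)"
    "X \<subseteq> U \<Longrightarrow> card X \<le> e \<Longrightarrow> (\<And>x. x \<in> X \<Longrightarrow> v x < 2 ^ w) \<Longrightarrow> length (enc X v) = b"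
    "X \<subseteq> U \<Longrightarrow> card X \<le> e \<Longrightarrow> (\<And>x. x \<in> X \<Longrightarrow> v x < 2 ^ w) \<Longrightarrow> contains m 0 (enc X v) \<Longrightarrow>
      x \<in> X \<Longrightarrow> get x m = v x"
  using assms unfolding retrieval_by_def by simp_all

text \<open>The values lie in a table of \<open>12 * e\<close> slots addressed by a perfect hash
  function. A query outside \<open>X\<close> yields some arbitrary number, because the keys
  themselves are not stored.\<close>

lemma retrieval_exists:
  fixes U :: "'a set" and k l e w :: nat
  assumes "finite U" "card U \<le> 2 ^ (2 * k)" "k = 2 ^ (4 * l)" "0 < l" "e \<le> 2 ^ k" "w \<le> 2 * k"
  obtains b where "b \<le> 60 * e * (l + w)" "retrieval k 34 U e w b"
proof (cases "e = 0")
  case True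
  have "retrieval k 34 U e w 0"
    unfolding retrieval_def retrieval_by_def
    by (rule exI[of _ "\<lambda>_ _. []"], rule exI[of _ "\<lambda>_ _. 0"])
       (use assms(1) True in \<open>auto intro: probes_const simp: finite_subset dest: rev_finite_subset\<close>)
  then show ?thesis using that[of 0] by simp
next
  case False
  then have "0 < e" by simp
  obtain enc :: "'a set \<Rightarrow> bool list" and H b pos where
    H: "b \<le> 60 * e * l" "\<And>x. probes k 32 (H x)" "\<And>X. length (enc X) = b"
    "\<And>X. X \<subseteq> U \<Longrightarrow> card X \<le> e \<Longrightarrow> inj_on (pos X) X"
    "\<And>X x. X \<subseteq> U \<Longrightarrow> card X \<le> e \<Longrightarrow> x \<in> X \<Longrightarrow> pos X x < 12 * e"
    "\<And>X x m. X \<subseteq> U \<Longrightarrow> card X \<le> e \<Longrightarrow> x \<in> X \<Longrightarrow> contains m 0 (enc X) \<Longrightarrow> H x m = pos X x"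
    by (rule perfect_hash[OF assms(1-4) \<open>0 < e\<close> assms(5)]) blast
  define enc' where "enc' X v = enc X @ array_bits w (12 * e) (\<lambda>i. v (inv_into X (pos X) i))"
    for X and v :: "'a \<Rightarrow> nat"
  define get where "get x m = (let i = H x m in read_nat (b + i * w) w m)" for x m
  have "probes k (32 + 2) (get x)" for x
    unfolding get_def by (intro probes_Let H probes_read_nat) (use assms(6) in auto)
  moreover have "length (enc' X v) = b + 12 * e * w" for X v by (simp add: enc'_def H)
  moreover have "get x m = v x"
    if X: "X \<subseteq> U" "card X \<le> e" "\<forall>x\<in>X. v x < 2 ^ w" and m: "contains m 0 (enc' X v)" and x: "x \<in> X"
    for X v m x
  proof -
    have con: "contains m 0 (enc X)" "contains m b (array_bits w (12 * e) (\<lambda>i. v (inv_into X (pos X) i)))"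
      using m by (auto simp: enc'_def contains_append H(3))
    have "inv_into X (pos X) (pos X x) = x" using H(4)[OF X(1,2)] x by simp
    then show ?thesis
      using read_array[OF con(2) H(5)[OF X(1,2) x]] X(3) x H(6)[OF X(1,2) x con(1)] by (simp add: get_def)
  qed
  ultimately have "retrieval k 34 U e w (b + 12 * e * w)"
    unfolding retrieval_def retrieval_by_def by (intro exI[of _ enc'] exI[of _ get]) simp
  moreover have "b + 12 * e * w \<le> 60 * e * (l + w)" using H(1) by (simp add: algebra_simps)
  ultimately show ?thesis using that by blast
qed

section \<open>Rank and select by blocks\<close>

lemma card_less_nth_sorted:
  fixes D :: "nat set"
  assumes "finite D" "i < card D"
  shows "card {z \<in> D. z < sorted_list_of_set D ! i} = i"
proof -
  let ?xs = "sorted_list_of_set D"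
  have len: "length ?xs = card D" by simp
  have mono: "?xs ! a < ?xs ! b" if "a < b" "b < card D" for a b
    using sorted_wrt_nth_less[OF strict_sorted_list_of_set[of D] that(1)] that(2) by simp
  have "{z \<in> D. z < ?xs ! i} = (!) ?xs ` {..<i}"
  proof (intro equalityI subsetI)
    fix z assume z: "z \<in> {z \<in> D. z < ?xs ! i}"
    then obtain j where j: "j < card D" "z = ?xs ! j"
      using assms(1) by (metis (mono_tags, lifting) in_set_conv_nth len mem_Collect_eq set_sorted_list_of_set)
    then have "j < i" using z mono[of i j] by (cases "i < j") (auto simp: not_less le_less)
    then show "z \<in> (!) ?xs ` {..<i}" using j by blast
  next
    fix z assume "z \<in> (!) ?xs ` {..<i}"
    then obtain j where "j < i" "z = ?xs ! j" by blast
    then show "z \<in> {z \<in> D. z < ?xs ! i}"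
      using mono[of j i] assms nth_mem[of j ?xs] by simp
  qed
  moreover have "inj_on ((!) ?xs) {..<i}"
    using mono assms(2) by (intro linorder_inj_onI) (auto simp: less_le)
  ultimately show ?thesis by (simp add: card_image)
qed

lemma nth_sorted_eqI:
  fixes D :: "nat set"
  assumes "finite D" "y \<in> D" "card {z \<in> D. z < y} = i"
  shows "sorted_list_of_set D ! i = y"
proof -
  obtain j where j: "j < card D" "y = sorted_list_of_set D ! j"
    using assms(1,2) by (metis in_set_conv_nth length_sorted_list_of_set set_sorted_list_of_set)
  then show ?thesis using card_less_nth_sorted[OF assms(1) j(1)] assms(3) by simp
qed

lemma nth_sorted_mem:
  fixes D :: "nat set"
  assumes "finite D" "i < card D"
  shows "sorted_list_of_set D ! i \<in> D"
  using assms nth_mem[of i "sorted_list_of_set D"] by simp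

text \<open>The number \<open>r\<close> of elements is known to the query, and all codes for the
  same \<open>r\<close> have the same length \<open>b\<close>, so that the address of a structure
  follows from counts alone. Here rank counts the elements \<open>y \<le> x\<close>, and select
  counts from 0.\<close>

definition rank_select_by :: "nat \<Rightarrow> nat \<Rightarrow> nat \<Rightarrow> nat \<Rightarrow> nat \<Rightarrow> (nat set \<Rightarrow> bool list) \<Rightarrow>
    (nat \<Rightarrow> (nat \<Rightarrow> bool) \<Rightarrow> nat) \<Rightarrow> (nat \<Rightarrow> (nat \<Rightarrow> bool) \<Rightarrow> nat) \<Rightarrow> bool" where
  "rank_select_by k t U r b enc R Z \<longleftrightarrow> (\<forall>x. probes k t (R x)) \<and> (\<forall>i. probes k t (Z i)) \<and>
     (\<forall>D \<subseteq> {..<U}. card D = r \<longrightarrow> length (enc D) = b \<and>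
       (\<forall>m. contains m 0 (enc D) \<longrightarrow>
          (\<forall>x<U. R x m = card {y \<in> D. y \<le> x}) \<and> (\<forall>i<r. Z i m = sorted_list_of_set D ! i)))"

definition rank_select :: "nat \<Rightarrow> nat \<Rightarrow> nat \<Rightarrow> nat \<Rightarrow> nat \<Rightarrow> bool" where
  "rank_select k t U r b \<longleftrightarrow> (\<exists>enc R Z. rank_select_by k t U r b enc R Z)"

lemma rank_select_byD:
  assumes "rank_select_by k t U r b enc R Z"
  shows "probes k t (R x)" "probes k t (Z i)"
    "D \<subseteq> {..<U} \<Longrightarrow> card D = r \<Longrightarrow> length (enc D) = b"
    "D \<subseteq> {..<U} \<Longrightarrow> card D = r \<Longrightarrow> contains m 0 (enc D) \<Longrightarrow> x < U \<Longrightarrow> R x m = card {y \<in> D. y \<le> x}"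
    "D \<subseteq> {..<U} \<Longrightarrow> card D = r \<Longrightarrow> contains m 0 (enc D) \<Longrightarrow> i < r \<Longrightarrow> Z i m = sorted_list_of_set D ! i"
  using assms unfolding rank_select_by_def by simp_all

lemma rank_selectI:
  assumes "\<And>x. probes k t (R x)" "\<And>i. probes k t (Z i)"
    "\<And>D. D \<subseteq> {..<U} \<Longrightarrow> card D = r \<Longrightarrow> length (enc D) = b"
    "\<And>D m x. D \<subseteq> {..<U} \<Longrightarrow> card D = r \<Longrightarrow> contains m 0 (enc D) \<Longrightarrow> x < U \<Longrightarrow> R x m = card {y \<in> D. y \<le> x}"
    "\<And>D m i. D \<subseteq> {..<U} \<Longrightarrow> card D = r \<Longrightarrow> contains m 0 (enc D) \<Longrightarrow> i < r \<Longrightarrow> Z i m = sorted_list_of_set D ! i"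
  shows "rank_select k t U r b"
  unfolding rank_select_def rank_select_by_def
  by (rule exI[of _ enc], rule exI[of _ R], rule exI[of _ Z]) (simp add: assms)

lemma rank_select_pad:
  assumes "rank_select k t U r b" "b \<le> b'" "t \<le> t'"
  shows "rank_select k t' U r b'"
proof -
  obtain enc R Z where e: "rank_select_by k t U r b enc R Z"
    using assms(1) unfolding rank_select_def by blast
  show ?thesis
    by (rule rank_selectI[where enc = "\<lambda>D. enc D @ replicate (b' - b) False" and R = R and Z = Z])
       (use rank_select_byD[OF e] assms(2,3) in \<open>auto simp: contains_append intro: probes_mono\<close>)
qed

lemma rank_select_vacuous:
  assumes "U < r" shows "rank_select k t U r b"
proof -
  have "card D \<noteq> r" if "D \<subseteq> {..<U}" for D
    using card_mono[OF _ that] assms by simp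
  then show ?thesis
    by (intro rank_selectI[where enc = "\<lambda>_. []" and R = "\<lambda>_ _. 0" and Z = "\<lambda>_ _. 0"])
       (auto intro: probes_const)
qed

text \<open>The code is the index of the set among all \<open>r\<close>-subsets. It is read as a
  whole and decoded, and decoding is free.\<close>

lemma rank_select_direct:
  assumes "U choose r \<le> 2 ^ b" "b \<le> t * k"
  shows "rank_select k t U r b"
proof -
  let ?A = "{D. D \<subseteq> {..<U} \<and> card D = r}"
  have "card ?A = U choose r" using n_subsets[of "{..<U}" r] by simp
  then obtain enc :: "nat set \<Rightarrow> bool list" and dec where
    e: "\<And>x. length (enc x) = b" "\<And>x. x \<in> ?A \<Longrightarrow> dec (enc x) = x"
    using finite_code[of ?A b] assms(1) by auto
  show ?thesis
  proof (rule rank_selectI[where enc = enc and R = "\<lambda>x m. card {y \<in> dec (map m [0..<0+b]). y \<le> x}"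
      and Z = "\<lambda>i m. sorted_list_of_set (dec (map m [0..<0+b])) ! i"])
    show "probes k t (\<lambda>m. card {y \<in> dec (map m [0..<0+b]). y \<le> x})" for x
      by (rule probes_map[OF probes_bits[OF assms(2)]])
    show "probes k t (\<lambda>m. sorted_list_of_set (dec (map m [0..<0+b])) ! i)" for i
      by (rule probes_map[OF probes_bits[OF assms(2)]])
    show "length (enc D) = b" for D by (rule e)
    have dec: "dec (map m [0..<0+b]) = D"
      if "D \<subseteq> {..<U}" "card D = r" "contains m 0 (enc D)" for D m
      using contains_map[OF that(3)] e that by simp
    show "card {y \<in> dec (map m [0..<0+b]). y \<le> x} = card {y \<in> D. y \<le> x}"
      if "D \<subseteq> {..<U}" "card D = r" "contains m 0 (enc D)" for D m x by (simp only: dec[OF that])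
    show "sorted_list_of_set (dec (map m [0..<0+b])) ! i = sorted_list_of_set D ! i"
      if "D \<subseteq> {..<U}" "card D = r" "contains m 0 (enc D)" for D m i by (simp only: dec[OF that])
  qed
qed

section \<open>Block counts and directories\<close>

definition block_counts :: "nat \<Rightarrow> (nat \<Rightarrow> nat) \<Rightarrow> nat \<Rightarrow> (nat \<Rightarrow> nat) \<Rightarrow> bool" where
  "block_counts F u r c \<longleftrightarrow> c 0 = 0 \<and> c F = r \<and> (\<forall>i<F. c i \<le> c (Suc i) \<and> c (Suc i) \<le> c i + u i)"

lemma block_counts_mono:
  assumes "block_counts F u r c" "i \<le> j" "j \<le> F"
  shows "c i \<le> c j"
  using assms(2,3)
proof (induction j rule: dec_induct)
  case (step n)
  then have "c n \<le> c (Suc n)" using assms(1) by (simp add: block_counts_def)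
  then show ?case using step by simp
qed simp

lemma block_counts_le: "block_counts F u r c \<Longrightarrow> i \<le> F \<Longrightarrow> c i \<le> r"
  using block_counts_mono[of F u r c i F] by (simp add: block_counts_def)

lemma block_counts_find:
  assumes "block_counts F u r c" "j < r"
  shows "\<exists>i<F. c i \<le> j \<and> j < c (Suc i)"
proof -
  let ?i = "LEAST i. j < c i"
  have F: "j < c F" "c 0 = 0" using assms by (auto simp: block_counts_def)
  have i: "j < c ?i" using F(1) by (rule LeastI)
  have "?i \<le> F" using F(1) by (rule Least_le)
  moreover obtain i' where i': "?i = Suc i'" using i F by (cases ?i) auto
  moreover have "\<not> j < c i'" using not_less_Least[of i' "\<lambda>i. j < c i"] i' by simp
  ultimately show ?thesis using i by (intro exI[of _ i']) auto
qed

text \<open>Here \<open>c i\<close> counts the elements in the first \<open>i\<close> blocks,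
  \<open>u i\<close> is the size of block \<open>i\<close>, and \<open>b i r'\<close> the length of
  its code if it holds \<open>r'\<close> elements. \<open>Q i\<close> yields the counts before and
  after block \<open>i\<close> and the address of its code relative to the end of the directory;
  \<open>J j\<close> yields the block of the \<open>j\<close>-th element.\<close>

definition directory_by :: "nat \<Rightarrow> nat \<Rightarrow> nat \<Rightarrow> (nat \<Rightarrow> nat) \<Rightarrow> nat \<Rightarrow> (nat \<Rightarrow> nat \<Rightarrow> nat) \<Rightarrow> nat \<Rightarrow>
    ((nat \<Rightarrow> nat) \<Rightarrow> bool list) \<Rightarrow> (nat \<Rightarrow> (nat \<Rightarrow> bool) \<Rightarrow> nat \<times> nat \<times> nat) \<Rightarrow>
    (nat \<Rightarrow> (nat \<Rightarrow> bool) \<Rightarrow> nat) \<Rightarrow> bool" where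
  "directory_by k t F u r b a enc Q J \<longleftrightarrow> (\<forall>i. probes k t (Q i)) \<and> (\<forall>j. probes k t (J j)) \<and>
     (\<forall>c. block_counts F u r c \<longrightarrow> length (enc c) = a \<and>
       (\<forall>m. contains m 0 (enc c) \<longrightarrow>
          (\<forall>i<F. Q i m = (c i, c (Suc i), \<Sum>j<i. b j (c (Suc j) - c j))) \<and>
          (\<forall>j<r. J j m < F \<and> c (J j m) \<le> j \<and> j < c (Suc (J j m)))))"

definition directory ::
  "nat \<Rightarrow> nat \<Rightarrow> nat \<Rightarrow> (nat \<Rightarrow> nat) \<Rightarrow> nat \<Rightarrow> (nat \<Rightarrow> nat \<Rightarrow> nat) \<Rightarrow> nat \<Rightarrow> bool" where
  "directory k t F u r b a \<longleftrightarrow> (\<exists>enc Q J. directory_by k t F u r b a enc Q J)"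

lemma directory_byD:
  assumes "directory_by k t F u r b a enc Q J"
  shows "probes k t (Q i)" "probes k t (J j)"
    "block_counts F u r c \<Longrightarrow> length (enc c) = a"
    "block_counts F u r c \<Longrightarrow> contains m 0 (enc c) \<Longrightarrow> i < F \<Longrightarrow>
      Q i m = (c i, c (Suc i), \<Sum>j<i. b j (c (Suc j) - c j))"
    "block_counts F u r c \<Longrightarrow> contains m 0 (enc c) \<Longrightarrow> j < r \<Longrightarrow>
      J j m < F \<and> c (J j m) \<le> j \<and> j < c (Suc (J j m))"
  using assms unfolding directory_by_def by simp_all

lemma directoryI:
  assumes "\<And>i. probes k t (Q i)" "\<And>j. probes k t (J j)"
    "\<And>c. block_counts F u r c \<Longrightarrow> length (enc c) = a"
    "\<And>c m i. block_counts F u r c \<Longrightarrow> contains m 0 (enc c) \<Longrightarrow> i < F \<Longrightarrow>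
      Q i m = (c i, c (Suc i), \<Sum>j<i. b j (c (Suc j) - c j))"
    "\<And>c m j. block_counts F u r c \<Longrightarrow> contains m 0 (enc c) \<Longrightarrow> j < r \<Longrightarrow>
      J j m < F \<and> c (J j m) \<le> j \<and> j < c (Suc (J j m))"
  shows "directory k t F u r b a"
  unfolding directory_def directory_by_def
  by (rule exI[of _ enc], rule exI[of _ Q], rule exI[of _ J]) (simp add: assms)

text \<open>The code is a directory followed by the codes of the blocks. Rank asks \<open>Q\<close>
  for the block of \<open>x\<close>, select first asks \<open>J\<close> for the block and then
  \<open>Q\<close>; both continue inside one block.\<close>

lemma rank_select_blocks:
  assumes "U \<le> F * u" "0 < u"
    and dir: "directory k t F (\<lambda>i. min u (U - i * u)) r b a"
    and kids: "\<And>i r'. i < F \<Longrightarrow> rank_select k t' (min u (U - i * u)) r' (b i r')"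
    and B: "\<And>c. block_counts F (\<lambda>i. min u (U - i * u)) r c \<Longrightarrow> (\<Sum>i<F. b i (c (Suc i) - c i)) \<le> B"
  shows "rank_select k (t + (t + t')) U r (a + B)"
proof -
  let ?us = "\<lambda>i. min u (U - i * u)"
  obtain encd Q J where d: "directory_by k t F ?us r b a encd Q J"
    using dir unfolding directory_def by (elim exE) (rule that)
  note Q = directory_byD(1)[OF d] and J = directory_byD(2)[OF d] and dlen = directory_byD(3)[OF d]
    and Qc = directory_byD(4)[OF d] and Jc = directory_byD(5)[OF d]
  have "\<exists>enc R Z. i < F \<longrightarrow> rank_select_by k t' (?us i) r' (b i r') enc R Z" for i r'
    using kids unfolding rank_select_def by blast
  then obtain enc R Z where
    e: "\<And>i r'. i < F \<Longrightarrow> rank_select_by k t' (?us i) r' (b i r') (enc i r') (R i r') (Z i r')"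
    by metis
  define cnt where "cnt D i = card {y \<in> D. y < i * u}" for D i
  define blk where "blk D i = {y. y < u \<and> i * u + y \<in> D}" for D i
  define chunk where "chunk D i = enc i (cnt D (Suc i) - cnt D i) (blk D i)" for D i
  define body where "body D = encd (cnt D) @ concat (map (chunk D) [0..<F])" for D
  \<comment> \<open>Block structures exist only below \<open>F\<close>. The default 0 keeps the
    probe bound valid for all arguments and all memories.\<close>
  define R' where "R' x m = (if x div u < F then (let v = Q (x div u) m in
      fst v + R (x div u) (fst (snd v) - fst v) (x mod u) (shifted (a + snd (snd v)) m)) else 0)" for x m
  define Z' where "Z' j m = (let i = J j m in if i < F then (let v = Q i m in
      i * u + Z i (fst (snd v) - fst v) (j - fst v) (shifted (a + snd (snd v)) m)) else 0)" for j m
  have split: "card {y \<in> D. y < i * u + p} = cnt D i + card {y \<in> blk D i. y < p}"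
    if "p \<le> u" "finite D" for D i p
  proof -
    have "{y \<in> D. y < i * u + p} = {y \<in> D. y < i * u} \<union> (\<lambda>y. i * u + y) ` {y \<in> blk D i. y < p}"
    proof (intro equalityI subsetI)
      fix y assume y: "y \<in> {y \<in> D. y < i * u + p}"
      show "y \<in> {y \<in> D. y < i * u} \<union> (\<lambda>y. i * u + y) ` {y \<in> blk D i. y < p}"
      proof (cases "y < i * u")
        case False
        then have "y = i * u + (y - i * u)" by simp
        moreover have "y - i * u \<in> {y \<in> blk D i. y < p}" using False y that by (auto simp: blk_def)
        ultimately show ?thesis by blast
      qed (use y in auto)
    qed (auto simp: blk_def)
    moreover have "finite {y \<in> blk D i. y < p}" by (rule finite_subset[of _ "{..<p}"]) auto
    ultimately have "card {y \<in> D. y < i * u + p} = card {y \<in> D. y < i * u} + card ((\<lambda>y. i * u + y) ` {y \<in> blk D i. y < p})"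
      using that(2) by (subst card_Un_disjoint[symmetric]) auto
    then show ?thesis by (simp add: cnt_def card_image)
  qed
  have blk_sub: "blk D i \<subseteq> {..<?us i}" if "D \<subseteq> {..<U}" for D i
    using that by (auto simp: blk_def)
  have cnt_Suc: "cnt D (Suc i) = cnt D i + card (blk D i)" if "finite D" for D i
  proof -
    have "{y \<in> blk D i. y < u} = blk D i" by (auto simp: blk_def)
    then show ?thesis using split[OF order_refl that, of i] by (simp add: cnt_def add.commute)
  qed
  have bc: "block_counts F ?us r (cnt D)" if "D \<subseteq> {..<U}" "card D = r" for D
  proof -
    have fin: "finite D" using that finite_subset by blast
    have "{y \<in> D. y < F * u} = D" using that assms(1) by auto
    moreover have "card (blk D i) \<le> ?us i" for i
      using card_mono[OF _ blk_sub[OF that(1), of i]] by simp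
    ultimately show ?thesis using that cnt_Suc[OF fin] by (auto simp: block_counts_def cnt_def)
  qed
  have chunk_len: "length (chunk D i) = b i (cnt D (Suc i) - cnt D i)" if "D \<subseteq> {..<U}" "card D = r" "i < F" for D i
    using rank_select_byD(3)[OF e[OF that(3)] blk_sub[OF that(1)]] cnt_Suc[OF finite_subset[OF that(1)]]
    by (simp add: chunk_def)
  have len: "length (body D) \<le> a + B" if "D \<subseteq> {..<U}" "card D = r" for D
  proof -
    have "length (concat (map (chunk D) [0..<F])) = (\<Sum>i<F. length (chunk D i))"
      by (simp add: length_concat o_def interv_sum_list_conv_sum_set_nat atLeast0LessThan)
    also have "\<dots> = (\<Sum>i<F. b i (cnt D (Suc i) - cnt D i))"
      using chunk_len[OF that] by (intro sum.cong) auto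
    finally show ?thesis using dlen[OF bc[OF that]] B[OF bc[OF that]] by (simp add: body_def)
  qed
  have here: "Q i m = (cnt D i, cnt D (Suc i), \<Sum>j<i. b j (cnt D (Suc j) - cnt D j))"
    "contains (shifted (a + (\<Sum>j<i. b j (cnt D (Suc j) - cnt D j))) m) 0 (chunk D i)"
    if D: "D \<subseteq> {..<U}" "card D = r" and m: "contains m 0 (body D)" and i: "i < F" for D m i
  proof -
    have con: "contains m 0 (encd (cnt D))" "contains m a (concat (map (chunk D) [0..<F]))"
      using m dlen[OF bc[OF D]] by (auto simp: body_def contains_append)
    show "Q i m = (cnt D i, cnt D (Suc i), \<Sum>j<i. b j (cnt D (Suc j) - cnt D j))"
      using Qc[OF bc[OF D] con(1) i] .
    have "(\<Sum>j<i. length (chunk D j)) = (\<Sum>j<i. b j (cnt D (Suc j) - cnt D j))"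
      using chunk_len[OF D] i by (intro sum.cong) auto
    then show "contains (shifted (a + (\<Sum>j<i. b j (cnt D (Suc j) - cnt D j))) m) 0 (chunk D i)"
      using contains_concat[OF con(2) i] by (simp add: contains_shifted)
  qed
  show ?thesis
  \<comment> \<open>The blocks need at most \<open>B\<close> bits; padding makes the length the same
    for all \<open>D\<close>.\<close>
  proof (rule rank_selectI[where enc = "\<lambda>D. body D @ replicate (a + B - length (body D)) False"
        and R = R' and Z = Z'])
    show "probes k (t + (t + t')) (R' x)" for x
    proof (cases "x div u < F")
      case True
      have "probes k (t + t') (\<lambda>m. let v = Q (x div u) m in
         fst v + R (x div u) (fst (snd v) - fst v) (x mod u) (shifted (a + snd (snd v)) m))"
        by (intro probes_Let Q probes_map[OF probes_shifted]) (rule rank_select_byD[OF e[OF True]])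
      then have "probes k (t + (t + t')) (\<lambda>m. let v = Q (x div u) m in
         fst v + R (x div u) (fst (snd v) - fst v) (x mod u) (shifted (a + snd (snd v)) m))"
        by (rule probes_mono) simp
      then show ?thesis using True by (simp add: R'_def[abs_def])
    qed (simp add: R'_def[abs_def] probes_const)
    show "probes k (t + (t + t')) (Z' j)" for j
    proof -
      have "probes k (t + t') (\<lambda>m. if i < F then (let v = Q i m in
         i * u + Z i (fst (snd v) - fst v) (j - fst v) (shifted (a + snd (snd v)) m)) else 0)" for i
      proof (cases "i < F")
        case True
        have "probes k (t + t') (\<lambda>m. let v = Q i m in
           i * u + Z i (fst (snd v) - fst v) (j - fst v) (shifted (a + snd (snd v)) m))"
          by (intro probes_Let Q probes_map[OF probes_shifted]) (rule rank_select_byD[OF e[OF True]])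
        then show ?thesis using True by simp
      qed (simp add: probes_const)
      then show ?thesis unfolding Z'_def by (intro probes_Let J)
    qed
    fix D assume D: "D \<subseteq> {..<U}" "card D = r"
    have fin: "finite D" using D finite_subset by blast
    show "length (body D @ replicate (a + B - length (body D)) False) = a + B"
      using len[OF D] by simp
    fix m assume "contains m 0 (body D @ replicate (a + B - length (body D)) False)"
    then have m: "contains m 0 (body D)" by (simp add: contains_append)
    have kid: "R i (cnt D (Suc i) - cnt D i) x (shifted (a + (\<Sum>j<i. b j (cnt D (Suc j) - cnt D j))) m) = card {y \<in> blk D i. y \<le> x}"
      if "i < F" "x < ?us i" for i x
      by (rule rank_select_byD(4)[OF e[OF that(1)] blk_sub[OF D(1)] _ here(2)[OF D m that(1), unfolded chunk_def] that(2)])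
         (simp add: cnt_Suc[OF fin])
    have kid2: "Z i (cnt D (Suc i) - cnt D i) j (shifted (a + (\<Sum>j<i. b j (cnt D (Suc j) - cnt D j))) m) = sorted_list_of_set (blk D i) ! j"
      if "i < F" "j < card (blk D i)" for i j
      by (rule rank_select_byD(5)[OF e[OF that(1)] blk_sub[OF D(1)] _ here(2)[OF D m that(1), unfolded chunk_def]])
         (simp_all add: cnt_Suc[OF fin] that)
    {
      fix x assume x: "x < U"
      have i: "x div u < F" using x assms(1,2) by (simp add: less_mult_imp_div_less)
      have "x div u * u + x mod u < U" using x by simp
      then have "x mod u < U - x div u * u" by linarith
      then have "x mod u < ?us (x div u)" using assms(2) by simp
      then have "R' x m = cnt D (x div u) + card {y \<in> blk D (x div u). y \<le> x mod u}"
        using i here(1)[OF D m i] kid[OF i] by (simp add: R'_def)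
      also have "\<dots> = card {y \<in> D. y < x div u * u + Suc (x mod u)}"
        using split[of "Suc (x mod u)" D "x div u"] assms(2) fin by (simp add: Suc_le_eq less_Suc_eq_le)
      also have "\<dots> = card {y \<in> D. y \<le> x}" by (simp add: less_Suc_eq_le)
      finally show "R' x m = card {y \<in> D. y \<le> x}" .
    }
    fix j assume j: "j < r"
    let ?i = "J j m"
    have "contains m 0 (encd (cnt D))" using m by (simp add: body_def contains_append)
    from Jc[OF bc[OF D] this j] have i: "?i < F" "cnt D ?i \<le> j" "j < cnt D (Suc ?i)" by auto
    let ?j = "j - cnt D ?i"
    have fb: "finite (blk D ?i)" using blk_sub[OF D(1)] finite_subset by blast
    have j': "?j < card (blk D ?i)" using i cnt_Suc[OF fin, of ?i] by simp
    let ?y = "sorted_list_of_set (blk D ?i) ! ?j"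
    have y: "?y \<in> blk D ?i" by (rule nth_sorted_mem[OF fb j'])
    have "card {z \<in> D. z < ?i * u + ?y} = cnt D ?i + ?j"
      using split[of ?y D ?i] y fin card_less_nth_sorted[OF fb j'] by (simp add: blk_def)
    then have "sorted_list_of_set D ! j = ?i * u + ?y"
      using y i by (intro nth_sorted_eqI fin) (auto simp: blk_def)
    then show "Z' j m = sorted_list_of_set D ! j"
      using i here(1)[OF D m i(1)] kid2[OF i(1) j'] by (simp add: Z'_def Let_def)
  qed
qed

section \<open>Rank and select in nearly dense universes\<close>

text \<open>If the list of all \<open>F + 1\<close> counts is short enough to be read at once, then
  everything else is computed from it.\<close>

lemma directory_direct:
  assumes "(r + 1) ^ (F + 1) \<le> 2 ^ a" "a \<le> t * k"
  shows "directory k t F u r b a"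
proof -
  let ?A = "{cs. set cs \<subseteq> {..r} \<and> length cs = F + 1}"
  have "card ?A = (r + 1) ^ (F + 1)" using card_lists_length_eq[of "{..r}" "F + 1"] by simp
  moreover have "finite ?A" by (intro finite_lists_length_eq) simp
  ultimately obtain enc :: "nat list \<Rightarrow> bool list" and dec where
    e: "\<And>x. length (enc x) = a" "\<And>x. x \<in> ?A \<Longrightarrow> dec (enc x) = x"
    using finite_code[of ?A a] assms(1) by auto
  define cs where "cs c = map c [0..<F + 1]" for c :: "nat \<Rightarrow> nat"
  define get where "get m = dec (map m [0..<0 + a])" for m
  have dec: "get m = cs c" if "block_counts F u r c" "contains m 0 (enc (cs c))" for c m
  proof -
    have "cs c \<in> ?A" using block_counts_le[OF that(1)] by (auto simp: cs_def)
    then show ?thesis using contains_map[OF that(2)] e by (simp add: get_def)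
  qed
  have nth: "cs c ! i = c i" if "i \<le> F" for c i
    using that unfolding cs_def by (subst nth_map_upt) auto
  have pg: "probes k t (\<lambda>m. g (get m))" for g :: "nat list \<Rightarrow> 'z"
    unfolding get_def by (rule probes_map[OF probes_map[OF probes_bits[OF assms(2)]]])
  show ?thesis
  proof (rule directoryI[where enc = "\<lambda>c. enc (cs c)"
        and Q = "\<lambda>i m. (get m ! i, get m ! Suc i, \<Sum>j<i. b j (get m ! Suc j - get m ! j))"
        and J = "\<lambda>j m. SOME i. i < F \<and> get m ! i \<le> j \<and> j < get m ! Suc i"])
    show "probes k t (\<lambda>m. (get m ! i, get m ! Suc i, \<Sum>j<i. b j (get m ! Suc j - get m ! j)))" for i
      by (rule pg)
    show "probes k t (\<lambda>m. SOME i. i < F \<and> get m ! i \<le> j \<and> j < get m ! Suc i)" for j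
      by (rule pg)
    show "length (enc (cs c)) = a" for c by (rule e)
  next
    fix c m i assume "block_counts F u r c" "contains m 0 (enc (cs c))" "i < F"
    then show "(get m ! i, get m ! Suc i, \<Sum>j<i. b j (get m ! Suc j - get m ! j)) =
       (c i, c (Suc i), \<Sum>j<i. b j (c (Suc j) - c j))"
      by (simp add: dec nth)
  next
    fix c m j assume c: "block_counts F u r c" "contains m 0 (enc (cs c))" "j < r"
    have "\<exists>i. i < F \<and> get m ! i \<le> j \<and> j < get m ! Suc i"
      using block_counts_find[OF c(1,3)] by (auto simp: dec[OF c(1,2)] nth)
    from someI_ex[OF this] nth[symmetric, of _ c]
    show "(SOME i. i < F \<and> get m ! i \<le> j \<and> j < get m ! Suc i) < F \<and>
      c (SOME i. i < F \<and> get m ! i \<le> j \<and> j < get m ! Suc i) \<le> j \<and>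
      j < c (Suc (SOME i. i < F \<and> get m ! i \<le> j \<and> j < get m ! Suc i))"
      by (auto simp: dec[OF c(1,2)] nth Suc_le_eq)
  qed
qed

text \<open>To locate the block of the \<open>j\<close>-th element, ranks are grouped into runs of length \<open>q\<close>
  and the block \<open>\<beta>\<close> of the last element of each run is stored. Either \<open>j\<close> lies in \<open>\<beta>\<close>, or the first
  element of \<open>\<beta>\<close> lies in the run of \<open>j\<close>; so it suffices to tabulate, for every \<open>\<beta>\<close>, the
  run that contains the first element of \<open>\<beta>\<close>.\<close>

lemma directory_arrays:
  assumes sum: "\<And>c. block_counts F u r c \<Longrightarrow> (\<Sum>i<F. b i (c (Suc i) - c i)) < 2 ^ w"
    and "r < 2 ^ w" "F \<le> 2 ^ w" "w \<le> t * k" "0 < q"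
  shows "directory k (3 * t) F u r b ((F + 1) * w + F * w + (r div q + 1) * w + F * q * w)"
proof -
  define blk where "blk c j = (SOME i. i < F \<and> c i \<le> j \<and> j < c (Suc i))" for c :: "nat \<Rightarrow> nat" and j
  have blk: "blk c j < F" "c (blk c j) \<le> j" "j < c (Suc (blk c j))"
    if "block_counts F u r c" "j < r" for c j
  proof -
    have "\<exists>i. i < F \<and> c i \<le> j \<and> j < c (Suc i)" using block_counts_find[OF that] by blast
    from someI_ex[OF this] show "blk c j < F" "c (blk c j) \<le> j" "j < c (Suc (blk c j))"
      by (auto simp: blk_def)
  qed
  define ptr where "ptr c i = (\<Sum>j<i. b j (c (Suc j) - c j))" for c i
  \<comment> \<open>The last run of ranks may be incomplete, hence the cap at
    \<open>r - 1\<close>.\<close>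
  define last where "last c g = blk c (min (g * q + q - 1) (r - 1))" for c g
  define tab where "tab c x = blk c (min (c (x div q) div q * q + x mod q) (r - 1))" for c x
  define o2 where "o2 = (F + 1) * w"
  define o3 where "o3 = o2 + F * w"
  define o4 where "o4 = o3 + (r div q + 1) * w"
  define enc where "enc c = array_bits w (F + 1) c @ array_bits w F (ptr c) @
     array_bits w (r div q + 1) (last c) @ array_bits w (F * q) (tab c)" for c
  define Q where "Q i m = (let x = read_nat (0 + i * w) w m in (let y = read_nat (0 + Suc i * w) w m in
     (let z = read_nat (o2 + i * w) w m in (x, y, z))))" for i m
  define J where "J j m = (let \<beta> = read_nat (o3 + (j div q) * w) w m in
     (let x = read_nat (0 + \<beta> * w) w m in
      if x \<le> j then \<beta> else read_nat (o4 + (\<beta> * q + j mod q) * w) w m))" for j m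
  have con: "contains m 0 (array_bits w (F + 1) c)" "contains m o2 (array_bits w F (ptr c))"
    "contains m o3 (array_bits w (r div q + 1) (last c))" "contains m o4 (array_bits w (F * q) (tab c))"
    if "contains m 0 (enc c)" for c m
    using that by (simp_all add: enc_def contains_append o2_def o3_def o4_def add.assoc)
  have ptr: "ptr c i < 2 ^ w" if "block_counts F u r c" "i < F" for c i
  proof -
    have "ptr c i \<le> (\<Sum>j<F. b j (c (Suc j) - c j))"
      unfolding ptr_def using that(2) by (intro sum_mono2) auto
    then show ?thesis using sum[OF that(1)] by simp
  qed
  have cnt: "read_nat (0 + i * w) w m = c i" if "block_counts F u r c" "contains m 0 (enc c)" "i \<le> F" for c m i
    using read_array[OF con(1)[OF that(2)], of i] block_counts_le[OF that(1,3)] assms(2) that(3) by simp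
  have "directory k (3 * t) F u r b (length (enc (\<lambda>_. 0)))"
  proof (rule directoryI[where enc = enc and Q = Q and J = J])
    note rd = probes_read_nat[OF assms(4)]
    have "probes k (t + (t + (t + 0))) (Q i)" for i
      unfolding Q_def by (intro probes_Let rd probes_const)
    then show "probes k (3 * t) (Q i)" for i by (simp add: algebra_simps numeral_3_eq_3)
    have "probes k (t + (t + t)) (J j)" for j
      unfolding J_def by (intro probes_Let rd probes_if probes_const)
    then show "probes k (3 * t) (J j)" for j by (simp add: algebra_simps numeral_3_eq_3)
    show "length (enc c) = length (enc (\<lambda>_. 0))" for c by (simp add: enc_def)
  next
    fix c m i assume c: "block_counts F u r c" and m: "contains m 0 (enc c)" and i: "i < F"
    show "Q i m = (c i, c (Suc i), \<Sum>j<i. b j (c (Suc j) - c j))"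
      using cnt[OF c m, of i] cnt[OF c m, of "Suc i"] read_array[OF con(2)[OF m] i ptr[OF c i]] i
      by (simp add: Q_def Let_def ptr_def del: mult_Suc)
  next
    fix c m j assume c: "block_counts F u r c" and m: "contains m 0 (enc c)" and j: "j < r"
    let ?e = "min (j div q * q + q - 1) (r - 1)"
    let ?\<beta> = "last c (j div q)"
    have "j div q * q + j mod q = j" by simp
    moreover have "j mod q < q" using assms(5) by simp
    ultimately have je: "j \<le> ?e" "?e < r" using j by linarith+
    have be: "?\<beta> < F" "c ?\<beta> \<le> ?e" "?e < c (Suc ?\<beta>)" using blk[OF c je(2)] by (auto simp: last_def)
    have "j div q < r div q + 1" using j by (simp add: div_le_mono le_imp_less_Suc)
    then have rb: "read_nat (o3 + (j div q) * w) w m = ?\<beta>"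
      using read_array[OF con(3)[OF m]] be(1) assms(3) by simp
    have rc: "read_nat (0 + ?\<beta> * w) w m = c ?\<beta>" using cnt[OF c m] be(1) by simp
    show "J j m < F \<and> c (J j m) \<le> j \<and> j < c (Suc (J j m))"
    proof (cases "c ?\<beta> \<le> j")
      case True
      then have "J j m = ?\<beta>" unfolding J_def Let_def rb rc by simp
      then show ?thesis using True be(1) le_less_trans[OF je(1) be(3)] by simp
    next
      case False
      have lt: "?\<beta> * q + j mod q < F * q"
      proof -
        have "?\<beta> * q + j mod q < Suc ?\<beta> * q" using assms(5) by simp
        also have "\<dots> \<le> F * q" using be(1) by (intro mult_le_mono1) simp
        finally show ?thesis .
      qed
      have "c ?\<beta> div q = j div q"
      proof (rule antisym)
        have "c ?\<beta> \<le> j div q * q + q - 1" using be(2) by simp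
        then have "c ?\<beta> < Suc (j div q) * q" using assms(5) by simp
        then have "c ?\<beta> div q < Suc (j div q)" by (rule less_mult_imp_div_less)
        then show "c ?\<beta> div q \<le> j div q" by simp
        show "j div q \<le> c ?\<beta> div q" using False by (intro div_le_mono) simp
      qed
      then have t: "tab c (?\<beta> * q + j mod q) = blk c j"
        using assms(5) j by (simp add: tab_def)
      have "read_nat (o4 + (?\<beta> * q + j mod q) * w) w m = blk c j"
        using read_array[OF con(4)[OF m] lt] t blk(1)[OF c j] assms(3) by simp
      then have "J j m = blk c j" unfolding J_def Let_def rb rc using False by simp
      then show ?thesis using blk[OF c j] by simp
    qed
  qed
  moreover have "length (enc (\<lambda>_. 0)) = (F + 1) * w + F * w + (r div q + 1) * w + F * q * w"
    by (simp add: enc_def)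
  ultimately show ?thesis by simp
qed

section \<open>The cost of cutting a universe into blocks\<close>

lemma binomial_mult_le: "(a choose i) * (b choose j) \<le> (a + b) choose (i + j)"
proof -
  have "(a choose i) * (b choose (i + j - i)) \<le> (\<Sum>k\<le>i + j. (a choose k) * (b choose (i + j - k)))"
    by (rule member_le_sum) auto
  then show ?thesis by (simp add: vandermonde)
qed

text \<open>Choosing in each block separately is one way of choosing in the union, so fixing the
  block counts can only reduce the information content.\<close>

lemma sum_log_binomial_le:
  fixes F :: nat
  assumes "\<And>i. i < F \<Longrightarrow> r i \<le> u i"
  shows "(\<Sum>i<F. log 2 (real (u i choose r i))) \<le> log 2 (real ((\<Sum>i<F. u i) choose (\<Sum>i<F. r i)))"
  using assms
proof (induction F)
  case (Suc F)
  have le: "(\<Sum>i<F. r i) \<le> (\<Sum>i<F. u i)" using Suc.prems by (intro sum_mono) simp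
  let ?a = "(\<Sum>i<F. u i) choose (\<Sum>i<F. r i)"
  have pos: "0 < ?a" "0 < u F choose r F" using le Suc.prems by (simp_all add: zero_less_binomial)
  have "(\<Sum>i<Suc F. log 2 (real (u i choose r i))) \<le> log 2 (real ?a) + log 2 (real (u F choose r F))"
    using Suc by simp
  also have "\<dots> = log 2 (real (?a * (u F choose r F)))"
    using pos by (simp add: log_mult)
  also have "\<dots> \<le> log 2 (real ((\<Sum>i<Suc F. u i) choose (\<Sum>i<Suc F. r i)))"
  proof -
    have "?a * (u F choose r F) \<le> (\<Sum>i<Suc F. u i) choose (\<Sum>i<Suc F. r i)"
      using binomial_mult_le by simp
    moreover have "0 < ?a * (u F choose r F)" using pos by simp
    ultimately show ?thesis by (subst log_le_cancel_iff) (auto simp del: of_nat_mult)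
  qed
  finally show ?case .
qed simp

lemma sum_block_sizes: "(\<Sum>i<F. min u (U - i * u)) = min (F * u) (U::nat)"
  by (induction F) (auto simp: min_def)

text \<open>Each block loses at most two bits, the constant 1 and the rounding, and the losses
  \<open>\<gamma>\<close> per element add up to \<open>\<gamma> * r\<close>.\<close>

lemma sum_block_lengths_le:
  fixes \<gamma> :: real
  assumes c: "block_counts F (\<lambda>i. min u (U - i * u)) r c" and "U \<le> F * u" "0 \<le> \<gamma>"
  shows "real (\<Sum>i<F. nat \<lceil>log 2 (real (min u (U - i * u) choose (c (Suc i) - c i))) + 1 + \<gamma> * real (c (Suc i) - c i)\<rceil>)
    \<le> log 2 (real (U choose r)) + 2 * real F + \<gamma> * real r"
proof -
  let ?u = "\<lambda>i. min u (U - i * u)" and ?r = "\<lambda>i. c (Suc i) - c i"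
  have le: "?r i \<le> ?u i" if "i < F" for i
    using c that unfolding block_counts_def by (metis add.commute le_diff_conv)
  have sum_r: "(\<Sum>i<G. ?r i) = c G" if "G \<le> F" for G
    using that
  proof (induction G)
    case 0
    then show ?case using c by (simp add: block_counts_def)
  next
    case (Suc G)
    then show ?case using c by (simp add: block_counts_def)
  qed
  have cF: "c F = r" using c by (simp add: block_counts_def)
  have "real (nat \<lceil>log 2 (real (?u i choose ?r i)) + 1 + \<gamma> * real (?r i)\<rceil>)
      \<le> log 2 (real (?u i choose ?r i)) + 2 + \<gamma> * real (?r i)" if "i < F" for i
  proof -
    have "0 < ?u i choose ?r i" using le[OF that] by (simp add: zero_less_binomial)
    then have "0 \<le> log 2 (real (?u i choose ?r i))" by (intro zero_le_log_cancel_iff[THEN iffD2]) linarith+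
    moreover have "0 \<le> \<gamma> * real (?r i)" using assms(3) by simp
    ultimately show ?thesis by linarith
  qed
  then have "real (\<Sum>i<F. nat \<lceil>log 2 (real (?u i choose ?r i)) + 1 + \<gamma> * real (?r i)\<rceil>)
     \<le> (\<Sum>i<F. log 2 (real (?u i choose ?r i)) + 2 + \<gamma> * real (?r i))"
    unfolding of_nat_sum by (intro sum_mono) simp
  also have "\<dots> = (\<Sum>i<F. log 2 (real (?u i choose ?r i))) + 2 * real F + \<gamma> * real (\<Sum>i<F. ?r i)"
    by (simp only: sum.distrib of_nat_sum sum_distrib_left) simp
  also have "\<dots> \<le> log 2 (real ((\<Sum>i<F. ?u i) choose (\<Sum>i<F. ?r i))) + 2 * real F + \<gamma> * real (\<Sum>i<F. ?r i)"
    using sum_log_binomial_le[of F ?r ?u] le by simp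
  also have "\<dots> = log 2 (real (U choose r)) + 2 * real F + \<gamma> * real r"
    using assms(2) by (simp only: sum_r[OF order_refl] cF sum_block_sizes min_absorb2)
  finally show ?thesis .
qed

text \<open>At most \<open>q ^ 3\<close> elements of \<open>q\<close> bits each fit into one window
  of \<open>q ^ 4\<close> bits.\<close>

lemma rank_select_light:
  assumes "r \<le> U" "r \<le> q ^ 3" "U \<le> 2 ^ q" "log 2 (real (U choose r)) \<le> real b"
  shows "rank_select (q ^ 4) 1 U r b"
proof -
  have pos: "0 < real (U choose r)" using assms(1) by (simp add: zero_less_binomial)
  have "real (U choose r) \<le> 2 powr real b"
    using assms(4) pos by (simp add: log_le_iff)
  then have "real (U choose r) \<le> real (2 ^ b)" by (simp add: powr_realpow)
  then have 1: "U choose r \<le> 2 ^ b" by (rule of_nat_le_iff[THEN iffD1])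
  have "U choose r \<le> U ^ r" by (rule binomial_le_pow[OF assms(1)])
  also have "\<dots> \<le> (2 ^ q) ^ r" using assms(3) by (rule power_mono) simp
  also have "\<dots> = 2 ^ (q * r)" by (simp add: power_mult)
  also have "\<dots> \<le> 2 ^ (q ^ 4)"
    using assms(2) by (intro power_increasing) (simp_all add: numeral_eq_Suc)
  finally have 2: "U choose r \<le> 2 ^ (q ^ 4)" .
  have "rank_select (q ^ 4) 1 U r (min b (q ^ 4))"
    by (rule rank_select_direct) (use 1 2 in \<open>auto simp: min_def\<close>)
  then show ?thesis by (rule rank_select_pad) auto
qed

text \<open>A tree of degree \<open>q\<close> and height \<open>h\<close>. A node with at most
  \<open>q ^ 3\<close> elements is coded directly. Any other node has a directory of
  \<open>q + 1\<close> counts, which fits into one window; with the rounding of its \<open>q\<close>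
  blocks it costs at most \<open>q * (q + 3)\<close> bits, which is at most \<open>2 * r / q\<close>
  as \<open>r\<close> exceeds \<open>q ^ 3\<close>. So each level adds two probes and
  \<open>2 / q\<close> bits per element.\<close>

lemma rank_select_tree:
  fixes q h :: nat
  assumes q: "4 \<le> q" "q ^ H < 2 ^ q"
  shows "h \<le> H \<Longrightarrow> U \<le> q ^ h \<Longrightarrow>
    log 2 (real (U choose r)) + 1 + 2 * real h / real q * real r \<le> real b \<Longrightarrow>
    rank_select (q ^ 4) (1 + 2 * h) U r b"
proof (induction h arbitrary: U r b)
  case 0
  show ?case
  proof (cases "r \<le> U")
    case True
    have "(1::nat) \<le> q ^ 3" using q(1) by (intro one_le_power) simp
    moreover have "(1::nat) \<le> 2 ^ q" by (intro one_le_power) simp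
    moreover have "U \<le> 1" using 0 by simp
    ultimately have "r \<le> q ^ 3" "U \<le> 2 ^ q" using True by linarith+
    then show ?thesis using rank_select_light[of r U q b] True 0 by simp
  qed (simp add: rank_select_vacuous)
next
  case (Suc h)
  have "q ^ Suc h \<le> q ^ H" using Suc.prems(1) q(1) by (intro power_increasing) auto
  then have U2: "U < 2 ^ q" using Suc.prems(2) q(2) by linarith
  consider "U < r" | "r \<le> U" "r \<le> q ^ 3" | "r \<le> U" "q ^ 3 < r" by linarith
  then show ?case
  proof cases
    case 1
    then show ?thesis by (rule rank_select_vacuous)
  next
    case 2
    have "0 \<le> 2 * real (Suc h) / real q * real r" by simp
    then have "log 2 (real (U choose r)) \<le> real b" using Suc.prems(3) by linarith
    then have "rank_select (q ^ 4) 1 U r b" using 2 U2 by (intro rank_select_light) auto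
    then show ?thesis by (rule rank_select_pad) auto
  next
    case 3
    define \<gamma> where "\<gamma> = 2 * real h / real q"
    have \<gamma>: "0 \<le> \<gamma>" by (simp add: \<gamma>_def)
    let ?u = "\<lambda>i. min (q ^ h) (U - i * q ^ h)"
    let ?b = "\<lambda>i r. nat \<lceil>log 2 (real (?u i choose r)) + 1 + \<gamma> * real r\<rceil>"
    let ?B = "nat \<lfloor>log 2 (real (U choose r)) + 2 * real q + \<gamma> * real r\<rfloor>"
    have pos: "0 \<le> log 2 (real (U choose r))"
      using zero_less_binomial[OF 3(1)] by (intro zero_le_log_cancel_iff[THEN iffD2]) linarith+
    have "rank_select (q ^ 4) (1 + (1 + (1 + 2 * h))) U r (q * (q + 1) + ?B)"
    proof (rule rank_select_blocks[where F = q and u = "q ^ h" and b = ?b])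
      show U: "U \<le> q * q ^ h" using Suc.prems(2) by simp
      show "0 < q ^ h" using q(1) by simp
      show "directory (q ^ 4) 1 q ?u r ?b (q * (q + 1))"
      proof (rule directory_direct)
        have "(r + 1) ^ (q + 1) \<le> (2 ^ q) ^ (q + 1)" using U2 3(1) by (intro power_mono) auto
        then show "(r + 1) ^ (q + 1) \<le> 2 ^ (q * (q + 1))" by (simp only: power_mult)
        have "q * (q + 1) \<le> q * (q * q * q)"
        proof (intro mult_le_mono2)
          have "q + 1 \<le> q * 4" using q(1) by simp
          also have "\<dots> \<le> q * (q * q)" using q(1) by (intro mult_le_mono2) (simp add: le_square order_trans[OF _ le_square])
          finally show "q + 1 \<le> q * q * q" by (simp add: mult.assoc)
        qed
        then show "q * (q + 1) \<le> 1 * q ^ 4" by (simp add: numeral_eq_Suc mult.assoc)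
      qed
      show "rank_select (q ^ 4) (1 + 2 * h) (?u i) r' (?b i r')" for i r'
        by (rule Suc.IH) (use Suc.prems(1) in \<open>auto simp: \<gamma>_def intro: real_nat_ceiling_ge\<close>)
      fix c assume "block_counts q ?u r c"
      from sum_block_lengths_le[OF this U \<gamma>]
      show "(\<Sum>i<q. ?b i (c (Suc i) - c i)) \<le> ?B" by (simp add: le_nat_floor)
    qed
    then show ?thesis
    proof (rule rank_select_pad)
      have "0 \<le> \<gamma> * real r" using \<gamma> by simp
      then have "real ?B \<le> log 2 (real (U choose r)) + 2 * real q + \<gamma> * real r"
        using pos by (intro of_nat_floor) linarith
      moreover have "real q * (real q + 1) + 2 * real q \<le> 2 * real r / real q"
      proof -
        have "real q * (real q * (real q + 3)) \<le> real q * (real q * (2 * real q))"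
          using q(1) by (intro mult_left_mono) auto
        also have "\<dots> = 2 * real (q ^ 3)" by (simp add: numeral_eq_Suc)
        also have "\<dots> \<le> 2 * real r" using 3(2) by (simp del: of_nat_power)
        finally show ?thesis using q(1) by (simp add: field_simps)
      qed
      moreover have "2 * real (Suc h) / real q * real r = \<gamma> * real r + 2 * real r / real q"
        using q(1) by (simp add: \<gamma>_def field_simps)
      ultimately have "real (q * (q + 1) + ?B) \<le> real b" using Suc.prems(3) by (simp add: algebra_simps)
      then show "q * (q + 1) + ?B \<le> b" by (rule of_nat_le_iff[THEN iffD1])
    qed simp
  qed
qed

text \<open>A larger universe is cut into \<open>F\<close> blocks of size \<open>q ^ H\<close>, each
  with its own tree. The summand 12 in \<open>H\<close> makes \<open>F * q ^ 12\<close> at most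
  \<open>6 * n\<close>, so that a directory in arrays with entries of \<open>3 * q ^ 4\<close> bits
  and runs of \<open>q ^ 6\<close> ranks costs \<open>O(n / q ^ 2)\<close> bits.\<close>

lemma rank_select_exists:
  fixes q g :: nat
  defines "H \<equiv> g + 12"
  assumes q: "64 \<le> q" "q ^ H < 2 ^ q" and U: "U \<le> 3 * n * q ^ g" and n: "n \<le> 2 ^ (q ^ 4)" and r: "r \<le> n"
    and b: "log 2 (real (U choose r)) + 1 + (2 * real H + 2) / real q * real n \<le> real b"
  shows "rank_select (q ^ 4) (19 + 2 * H) U r b"
proof (cases "U \<le> q ^ H")
  case True
  have "2 * real H / real q * real r \<le> (2 * real H + 2) / real q * real n"
    using r by (intro mult_mono divide_right_mono) auto
  then have "rank_select (q ^ 4) (1 + 2 * H) U r b"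
    using q b True by (intro rank_select_tree[where H = H]) auto
  then show ?thesis by (rule rank_select_pad) auto
next
  case False
  show ?thesis
  proof (cases "r \<le> U")
    case ru: True
    define u where "u = q ^ H"
    define F where "F = U div u + 1"
    define k where "k = q ^ 4"
    define \<gamma> where "\<gamma> = 2 * real H / real q"
    have u0: "0 < u" using q by (simp add: u_def)
    have n0: "0 < n" using False U by (cases n) auto
    have \<gamma>: "0 \<le> \<gamma>" by (simp add: \<gamma>_def)
    have "2 ^ (2 * H) \<le> q ^ H"
    proof -
      have "(4::nat) ^ H \<le> q ^ H" using q(1) by (intro power_mono) auto
      then show ?thesis by (simp add: power_mult)
    qed
    then have "(2::nat) ^ (2 * H) < 2 ^ q" using q(2) by linarith
    then have "2 * H < q" by simp
    then have \<gamma>1: "\<gamma> \<le> 1" using q(1) by (simp add: \<gamma>_def field_simps)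
    have UF: "U \<le> F * u"
    proof -
      have "U = U div u * u + U mod u" by simp
      moreover have "U mod u < u" using u0 by simp
      ultimately show ?thesis unfolding F_def add_mult_distrib by linarith
    qed
    have FU: "F * q ^ 12 \<le> 6 * n"
    proof -
      have "1 \<le> U div u" using False u0 by (simp add: u_def div_greater_zero_iff Suc_le_eq)
      then have "F * u \<le> 2 * (U div u * u)" unfolding F_def by simp
      also have "\<dots> \<le> 2 * U" by simp
      also have "\<dots> \<le> 6 * n * q ^ g" using U by simp
      finally have "(F * q ^ 12) * q ^ g \<le> (6 * n) * q ^ g"
        by (simp add: u_def H_def power_add ac_simps)
      then show ?thesis using q(1) by simp
    qed
    let ?u = "\<lambda>i. min u (U - i * u)"
    let ?b = "\<lambda>i r. nat \<lceil>log 2 (real (?u i choose r)) + 1 + \<gamma> * real r\<rceil>"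
    let ?B = "nat \<lfloor>log 2 (real (U choose r)) + 2 * real F + \<gamma> * real r\<rfloor>"
    let ?w = "3 * k"
    let ?a = "(F + 1) * ?w + F * ?w + (r div q ^ 6 + 1) * ?w + F * q ^ 6 * ?w"
    have pos: "0 \<le> log 2 (real (U choose r))"
      using zero_less_binomial[OF ru] by (intro zero_le_log_cancel_iff[THEN iffD2]) linarith+
    have sum: "(\<Sum>i<F. ?b i (c (Suc i) - c i)) \<le> ?B" if "block_counts F ?u r c" for c
      using sum_block_lengths_le[OF that UF \<gamma>] by (simp add: le_nat_floor)
    have B: "real ?B \<le> log 2 (real (U choose r)) + 2 * real F + \<gamma> * real r"
      using pos \<gamma> by (intro of_nat_floor) simp
    \<comment> \<open>Counts, addresses and block numbers are all at most
      \<open>16 * n * q ^ g\<close>, so entries of three windows suffice.\<close>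
    have big: "16 * n * q ^ g < 2 ^ ?w"
    proof -
      have "q ^ g \<le> q ^ H" using q(1) by (intro power_increasing) (auto simp: H_def)
      then have "16 * n * q ^ g < 16 * n * 2 ^ q" using q(2) n0 by simp
      also have "\<dots> \<le> 2 ^ 4 * 2 ^ k * 2 ^ q" using n by (simp add: k_def)
      also have "\<dots> = 2 ^ (4 + k + q)" by (simp add: power_add)
      also have "\<dots> \<le> 2 ^ ?w"
      proof -
        have "q \<le> k" unfolding k_def using q(1) by (intro self_le_power) auto
        then show ?thesis using q(1) by (intro power_increasing) auto
      qed
      finally show ?thesis .
    qed
    have FB: "?B < 2 ^ ?w" "F \<le> 2 ^ ?w" "r < 2 ^ ?w"
    proof -
      have q1: "1 \<le> q ^ g" using q(1) by (intro one_le_power) simp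
      have nq: "n \<le> n * q ^ g" using q1 by simp
      have "F \<le> F * q ^ 12" using q(1) by simp
      then have F6: "F \<le> 6 * n" using FU by linarith
      have "log 2 (real (U choose r)) \<le> log 2 (real (2 ^ U))"
        using of_nat_mono[OF binomial_le_pow2[of U r], where 'a = real] zero_less_binomial[OF ru]
        by (intro log_le_cancel_iff[THEN iffD2]) auto
      also have "\<dots> = real U" by (simp add: log_nat_power)
      finally have "log 2 (real (U choose r)) \<le> real U" .
      moreover have "\<gamma> * real r \<le> 1 * real n" using \<gamma>1 \<gamma> r by (intro mult_mono) auto
      ultimately have "real ?B \<le> real (U + 2 * F + n)" using B by simp
      then have "?B \<le> U + 2 * F + n" by linarith
      also have "\<dots> \<le> 16 * n * q ^ g" using U F6 nq by linarith
      finally show "?B < 2 ^ ?w" using big by linarith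
      show "F \<le> 2 ^ ?w" "r < 2 ^ ?w" using big F6 nq r n0 by linarith+
    qed
    have "rank_select k (9 + (9 + (1 + 2 * H))) U r (?a + ?B)"
    proof (rule rank_select_blocks[where F = F and u = u and b = ?b, OF UF u0 _ _ sum])
      have "directory k (3 * 3) F ?u r ?b ?a"
        by (rule directory_arrays) (use sum FB q(1) in \<open>auto intro: le_less_trans[OF sum]\<close>)
      then show "directory k 9 F ?u r ?b ?a" by simp
      show "rank_select k (1 + 2 * H) (?u i) r' (?b i r')" for i r'
        unfolding k_def
        by (rule rank_select_tree[where H = H]) (use q in \<open>auto simp: \<gamma>_def u_def intro: real_nat_ceiling_ge\<close>)
    qed
    then have "rank_select k (19 + 2 * H) U r (?a + ?B)" by (rule rank_select_pad) auto
    then have "rank_select k (19 + 2 * H) U r b"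
    proof (rule rank_select_pad)
      define Q N f rr where "Q = real q" and "N = real n" and "f = real F" and "rr = real (r div q ^ 6)"
      have Q: "64 \<le> Q" using q(1) by (simp add: Q_def)
      have "real (F * q ^ 12) \<le> real (6 * n)" using FU by (rule of_nat_mono)
      then have fQ: "f * Q ^ 12 \<le> 6 * N" by (simp add: f_def Q_def N_def)
      have f1: "1 \<le> f" by (simp add: f_def F_def)
      have "r div q ^ 6 * q ^ 6 \<le> n" using r by (meson div_times_less_eq_dividend le_trans)
      then have "real (r div q ^ 6 * q ^ 6) \<le> real n" by (rule of_nat_mono)
      then have rr: "rr * Q ^ 6 \<le> N" by (simp add: rr_def Q_def N_def)
      have Q2: "Q ^ 2 > 0" using Q by simp
      have fQ10: "f * Q ^ 10 \<le> 6 * N / Q\<^sup>2" 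
        using fQ Q2 by (simp add: pos_le_divide_eq mult.assoc flip: power_add)
      have rQ4: "rr * Q ^ 4 \<le> N / Q\<^sup>2"
        using rr Q2 by (simp add: pos_le_divide_eq mult.assoc flip: power_add)
      have "(14::real) \<le> 64 ^ 6" by simp
      also have "(64::real) ^ 6 \<le> Q ^ 6" using Q by (intro power_mono) auto
      finally have Q6: "14 \<le> Q ^ 6" .
      have "14 * (f * Q ^ 4) \<le> Q ^ 6 * (f * Q ^ 4)"
        using Q6 f1 Q by (intro mult_right_mono) auto
      also have "\<dots> = f * Q ^ 10" by (simp add: ac_simps flip: power_add)
      finally have f4: "14 * (f * Q ^ 4) \<le> f * Q ^ 10" .
      have Q4: "1 \<le> Q ^ 4" using Q by (intro one_le_power) simp
      have fQ4: "f \<le> f * Q ^ 4" "Q ^ 4 \<le> f * Q ^ 4" using f1 Q4 by (simp_all add: mult_le_cancel_left1 mult_le_cancel_right1)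
      have "real ?a + 2 * f = 6 * (f * Q ^ 4) + 6 * Q ^ 4 + 3 * (rr * Q ^ 4) + 3 * (f * Q ^ 10) + 2 * f"
        by (simp add: f_def Q_def rr_def k_def algebra_simps flip: power_add)
      \<comment> \<open>All terms of order \<open>f * Q ^ 4\<close> are absorbed into one more
        \<open>f * Q ^ 10\<close>, which gives \<open>4 * 6 + 3 = 27\<close>; \<open>Q\<close>
        exceeds this constant.\<close>
      also have "\<dots> \<le> 27 * (N / Q\<^sup>2)" using fQ10 rQ4 f4 fQ4 by simp
      also have "\<dots> \<le> Q * (N / Q\<^sup>2)" using Q by (intro mult_right_mono) (auto simp: N_def)
      also have "\<dots> = N / Q" using Q by (simp add: power2_eq_square)
      finally have "real ?a + 2 * f \<le> N / Q" .
      moreover have "\<gamma> * real r \<le> \<gamma> * N" using \<gamma> r by (intro mult_left_mono) (auto simp: N_def)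
      moreover have "(2 * real H + 2) / real q * real n = \<gamma> * N + 2 * (N / Q)"
        using q(1) by (simp add: \<gamma>_def N_def Q_def field_simps)
      moreover have "0 \<le> N / Q" using Q by (simp add: N_def)
      ultimately have "real (?a + ?B) \<le> real b" using B b unfolding of_nat_add f_def by linarith
      then show "?a + ?B \<le> b" by (rule of_nat_le_iff[THEN iffD1])
    qed simp
    then show ?thesis by (simp add: k_def)
  qed (simp add: rank_select_vacuous)
qed

section \<open>Runs of equal leading bits\<close>

lemma nth_sorted_rank:
  fixes D :: "nat set"
  assumes "finite D" "y \<in> D"
  shows "sorted_list_of_set D ! (card {z \<in> D. z \<le> y} - 1) = y" "0 < card {z \<in> D. z \<le> y}"
    "card {z \<in> D. z \<le> y} \<le> card D"
proof -
  have "{z \<in> D. z \<le> y} = insert y {z \<in> D. z < y}" using assms(2) by auto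
  then have c: "card {z \<in> D. z \<le> y} = Suc (card {z \<in> D. z < y})" using assms(1) by simp
  then show "sorted_list_of_set D ! (card {z \<in> D. z \<le> y} - 1) = y" "0 < card {z \<in> D. z \<le> y}"
    using nth_sorted_eqI[OF assms refl] by simp_all
  show "card {z \<in> D. z \<le> y} \<le> card D" using assms(1) by (intro card_mono) auto
qed

text \<open>Intended for \<open>f i\<close> the leading part of the \<open>i\<close>-th smallest
  element. By monotonicity the runs of equal values are intervals. They are cut into chunks of
  \<open>k\<close> positions counted from the start of the run; \<open>chunk i\<close> is the first
  position of the chunk of \<open>i\<close>, not its number.\<close>

locale run_sequence =
  fixes f :: "nat \<Rightarrow> nat" and n k :: nat
  assumes mono: "\<And>i j. i \<le> j \<Longrightarrow> j < n \<Longrightarrow> f i \<le> f j" and k0: "0 < k"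
begin

definition "starts = {i. i < n \<and> (i = 0 \<or> f (i - 1) \<noteq> f i)}"
definition "start i = (LEAST a. f a = f i)"
definition "offset i = i - start i"
definition "chunk i = start i + offset i div k * k"

lemma start: "f (start i) = f i" "start i \<le> i"
  unfolding start_def by (rule LeastI[of _ i], simp) (rule Least_le, simp)

lemma start_cong: "f i = f j \<Longrightarrow> start i = start j"
  by (simp add: start_def)

lemma start_in: "i < n \<Longrightarrow> start i \<in> starts"
proof -
  assume i: "i < n"
  have "f (start i - 1) \<noteq> f i" if "start i \<noteq> 0"
    using not_less_Least[of "start i - 1" "\<lambda>a. f a = f i"] that by (auto simp: start_def)
  then show ?thesis using start[of i] i by (auto simp: starts_def)
qed

lemma le_start: "a \<in> starts \<Longrightarrow> a \<le> i \<Longrightarrow> i < n \<Longrightarrow> a \<le> start i"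
proof (rule ccontr)
  assume a: "a \<in> starts" "a \<le> i" "i < n" "\<not> a \<le> start i"
  then have "f (start i) \<le> f (a - 1)" "f (a - 1) \<le> f a" "f a \<le> f i" "a \<noteq> 0"
    by (auto intro!: mono)
  then show False using start(1)[of i] a(1) by (simp add: starts_def)
qed

lemma start_eq_iff: "i < n \<Longrightarrow> start i = i \<longleftrightarrow> i \<in> starts"
  using start_in[of i] le_start[of i i] start(2)[of i] by auto

lemma between_start: "start i \<le> j \<Longrightarrow> j \<le> i \<Longrightarrow> i < n \<Longrightarrow> start j = start i"
  using mono[of "start i" j] mono[of j i] start(1)[of i] by (intro start_cong) simp

lemma starts_le_eq: "i < n \<Longrightarrow> {a \<in> starts. a \<le> i} = {a \<in> starts. a \<le> start i}"
  using le_start[of _ i] start(2)[of i] by auto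

text \<open>Restricted to run starts, \<open>f\<close> is injective and still takes every value, so
  the \<open>j\<close>-th run start carries the \<open>j\<close>-th leading part. This links the
  structures for leading parts and for run starts.\<close>

lemma card_starts_le:
  assumes i: "i < n"
  shows "card {a \<in> starts. a \<le> i} = card {h \<in> f ` {..<n}. h \<le> f i}"
proof -
  have "inj_on f {a \<in> starts. a \<le> i}"
  proof (rule linorder_inj_onI)
    fix a b assume ab: "a < b" "a \<in> {a \<in> starts. a \<le> i}" "b \<in> {a \<in> starts. a \<le> i}"
    have "f a \<le> f (b - 1)" "f (b - 1) \<le> f b" using ab by (auto simp: starts_def intro!: mono)
    then show "f a \<noteq> f b" using ab by (auto simp: starts_def)
  qed auto
  moreover have "f ` {a \<in> starts. a \<le> i} = {h \<in> f ` {..<n}. h \<le> f i}"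
  proof (intro equalityI subsetI)
    fix h assume "h \<in> f ` {a \<in> starts. a \<le> i}"
    then show "h \<in> {h \<in> f ` {..<n}. h \<le> f i}" using i by (auto simp: starts_def intro: mono)
  next
    fix h assume h: "h \<in> {h \<in> f ` {..<n}. h \<le> f i}"
    then obtain j where j: "j < n" "h = f j" by blast
    have "start j \<le> i"
    proof (rule ccontr)
      assume "\<not> start j \<le> i"
      moreover have "f i \<le> f (start j)" using calculation start_in[OF j(1)] by (intro mono) (auto simp: starts_def)
      ultimately have "f i = f j" using h j start(1)[of j] by simp
      then show False using start_cong[of i j] start(2)[of i] \<open>\<not> start j \<le> i\<close> by simp
    qed
    then show "h \<in> f ` {a \<in> starts. a \<le> i}"
      using start_in[OF j(1)] start(1)[of j] j(2) by (intro image_eqI[of _ _ "start j"]) auto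
  qed
  ultimately show ?thesis by (metis card_image)
qed

lemma card_starts: "card starts = card (f ` {..<n})"
proof (cases n)
  case (Suc n')
  have "a \<le> n'" if "a \<in> starts" for a
  proof -
    have "a < n" using that by (simp add: starts_def)
    then show ?thesis using Suc by simp
  qed
  then have "{a \<in> starts. a \<le> n'} = starts" by blast
  moreover have "{h \<in> f ` {..<n}. h \<le> f n'} = f ` {..<n}" using Suc by (auto intro: mono)
  ultimately show ?thesis using card_starts_le[of n'] Suc by simp
next
  case 0
  then have "starts = {}" unfolding starts_def by blast
  then show ?thesis using 0 by simp
qed

lemma chunk_le: "chunk i \<le> i" "start i \<le> chunk i" "i = chunk i + offset i mod k"
proof -
  have "start i + offset i = i" using start(2)[of i] by (simp add: offset_def)
  moreover have "offset i = offset i div k * k + offset i mod k" by simp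
  ultimately show "i = chunk i + offset i mod k" unfolding chunk_def by linarith
  then show "chunk i \<le> i" by linarith
qed (simp add: chunk_def)

lemma chunk_chunk:
  assumes "i < n" shows "start (chunk i) = start i" "offset (chunk i) = offset i div k * k" "chunk (chunk i) = chunk i"
proof -
  show s: "start (chunk i) = start i" using between_start[OF chunk_le(2,1) assms] .
  show "offset (chunk i) = offset i div k * k"
    unfolding offset_def[of "chunk i"] s by (simp add: chunk_def)
  then show "chunk (chunk i) = chunk i" using s k0 by (simp add: chunk_def[of "chunk i"]) (simp add: chunk_def)
qed

lemma chunk_mono: assumes "i \<le> j" "j < n" shows "chunk i \<le> chunk j"
proof (cases "start j \<le> i")
  case True
  then have "start i = start j" using between_start assms by blast
  then show ?thesis using assms(1) unfolding chunk_def offset_def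
    by (simp add: div_le_mono diff_le_mono)
next
  case False
  then show ?thesis using chunk_le(1)[of i] chunk_le(2)[of j] by linarith
qed

text \<open>If \<open>z\<close> begins a chunk that is not the first of its run, then the
  \<open>k\<close> positions ending in \<open>z\<close> lie in that run and are no run starts; for
  different \<open>z\<close> they are disjoint. Hence at most \<open>e div k\<close> such chunks
  exist if \<open>e\<close> positions are no run starts, and a pointer of \<open>k\<close> bits for
  each is affordable.\<close>

lemma card_later_chunks:
  "k * card {i. i < n \<and> 0 < offset i \<and> k dvd offset i} \<le> card ({..<n} - starts)"
proof -
  let ?Z = "{i. i < n \<and> 0 < offset i \<and> k dvd offset i}"
  have sub: "start (z - j) = start z" "offset (z - j) = offset z - j" "z - j \<in> {..<n} - starts" "j < offset z"
    if z: "z \<in> ?Z" and j: "j < k" for z j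
  proof -
    have "k \<le> offset z" using z by (auto intro: dvd_imp_le)
    then show lt: "j < offset z" using j by simp
    then have le: "start z \<le> z - j" by (simp add: offset_def)
    show s: "start (z - j) = start z" by (rule between_start[OF le]) (use z in auto)
    show "offset (z - j) = offset z - j" using s by (simp add: offset_def)
    show "z - j \<in> {..<n} - starts" using z lt s start_eq_iff[of "z - j"] by (auto simp: offset_def)
  qed
  have "inj_on (\<lambda>(z, j). z - j) (?Z \<times> {..<k})"
  proof (rule inj_onI, clarify)
    fix z j z' j' assume a: "z < n" "0 < offset z" "k dvd offset z" "j < k"
      "z' < n" "0 < offset z'" "k dvd offset z'" "j' < k" and eq: "z - j = z' - j'"
    have S: "start (z - j) = start z" "offset (z - j) = offset z - j" "j < offset z" using sub[of z j] a by auto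
    have S': "start (z' - j') = start z'" "offset (z' - j') = offset z' - j'" "j' < offset z'" using sub[of z' j'] a by auto
    obtain c c' where c: "offset z = k * c" "offset z' = k * c'" using a by (auto elim!: dvdE)
    \<comment> \<open>Rounding up to a multiple of \<open>k\<close> recovers \<open>z\<close> from
      \<open>z - j\<close>.\<close>
    have "(k * c - j + (k - 1)) div k = c" if "j < k" "j < k * c" for c j
    proof -
      have "k * c - j + (k - 1) = (k - 1 - j) + c * k" using that by (simp add: mult.commute)
      moreover have "k - 1 - j < k" using k0 by simp
      ultimately show ?thesis using k0 by simp
    qed
    then have "c = c'" using S S' eq c a by metis
    then have "offset z = offset z'" "start z = start z'" using c S S' eq by auto
    then have "z = z'" using start(2)[of z] start(2)[of z'] by (simp add: offset_def)
    moreover have "j = j'" using eq S(3) S'(3) \<open>z = z'\<close> by (simp add: offset_def)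
    ultimately show "z = z' \<and> j = j'" by simp
  qed
  moreover have "(\<lambda>(z, j). z - j) ` (?Z \<times> {..<k}) \<subseteq> {..<n} - starts" using sub(3) by auto
  ultimately have "card (?Z \<times> {..<k}) \<le> card ({..<n} - starts)" by (intro card_inj_on_le) auto
  then show ?thesis by (simp add: mult.commute)
qed

end

section \<open>Longest common prefixes, measured by the number of discarded bits\<close>

definition prefix_shift :: "nat set \<Rightarrow> nat" where
  "prefix_shift A = (LEAST t. \<forall>a\<in>A. \<forall>b\<in>A. a div 2 ^ t = b div 2 ^ t)"

lemma prefix_shift:
  assumes "\<And>a. a \<in> A \<Longrightarrow> a < 2 ^ k"
  shows "prefix_shift A \<le> k" "a \<in> A \<Longrightarrow> b \<in> A \<Longrightarrow> a div 2 ^ prefix_shift A = b div 2 ^ prefix_shift A"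
proof -
  let ?P = "\<lambda>t. \<forall>a\<in>A. \<forall>b\<in>A. a div 2 ^ t = b div 2 ^ t"
  have P: "?P k" using assms by simp
  show "prefix_shift A \<le> k" unfolding prefix_shift_def using P by (rule Least_le)
  show "a \<in> A \<Longrightarrow> b \<in> A \<Longrightarrow> a div 2 ^ prefix_shift A = b div 2 ^ prefix_shift A"
    unfolding prefix_shift_def using LeastI[of ?P, OF P] by blast
qed

text \<open>The element of \<open>A\<close> that continues the common prefix with \<open>1\<close> precedes the element of \<open>B\<close> that
  continues it with \<open>0\<close>, so equal prefixes would contradict \<open>A < B\<close>.\<close>

lemma prefix_distinct:
  assumes "\<And>a. a \<in> A \<Longrightarrow> a < 2 ^ k" "\<And>b. b \<in> B \<Longrightarrow> b < 2 ^ k"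
    and less: "\<And>a b. a \<in> A \<Longrightarrow> b \<in> B \<Longrightarrow> a < b" and "x \<in> A" "y \<in> B"
    and shift: "prefix_shift A = t" "prefix_shift B = t"
  shows "x div 2 ^ t \<noteq> y div 2 ^ t"
proof
  assume eq: "x div 2 ^ t = y div 2 ^ t"
  let ?p = "x div 2 ^ t"
  have A: "a div 2 ^ t = ?p" if "a \<in> A" for a
    using prefix_shift(2)[OF assms(1) that assms(4)] shift by simp
  have B: "b div 2 ^ t = ?p" if "b \<in> B" for b
    using prefix_shift(2)[OF assms(2) that assms(5)] shift eq by simp
  show False
  proof (cases t)
    case 0
    then show False using less[OF assms(4,5)] eq by simp
  next
    case (Suc t')
    have half: "c div 2 ^ t = c div 2 ^ t' div 2" for c :: nat
      by (simp add: Suc mult.commute flip: div_mult2_eq)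
    \<comment> \<open>As \<open>t\<close> is minimal, both one-bit continuations of the common
      prefix occur.\<close>
    have branch: "(\<exists>c\<in>C. c div 2 ^ t' = 2 * ?p) \<and> (\<exists>c\<in>C. c div 2 ^ t' = 2 * ?p + 1)"
      if C: "prefix_shift C = t" "\<And>c. c \<in> C \<Longrightarrow> c div 2 ^ t = ?p" for C
    proof -
      have "\<not> (\<forall>a\<in>C. \<forall>b\<in>C. a div 2 ^ t' = b div 2 ^ t')"
        using not_less_Least[of t' "\<lambda>t. \<forall>a\<in>C. \<forall>b\<in>C. a div 2 ^ t = b div 2 ^ t"] C(1) Suc
        by (simp add: prefix_shift_def)
      then obtain a b where ab: "a \<in> C" "b \<in> C" "a div 2 ^ t' \<noteq> b div 2 ^ t'" by blast
      have two: "c div 2 ^ t' = 2 * ?p \<or> c div 2 ^ t' = 2 * ?p + 1" if "c \<in> C" for c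
        using C(2)[OF that] half[of c] by linarith
      show ?thesis using two[OF ab(1)] two[OF ab(2)] ab by metis
    qed
    obtain a where a: "a \<in> A" "a div 2 ^ t' = 2 * ?p + 1" using branch[OF shift(1) A] by blast
    obtain b where b: "b \<in> B" "b div 2 ^ t' = 2 * ?p" using branch[OF shift(2) B] by blast
    have "a div 2 ^ t' \<le> b div 2 ^ t'" using less[OF a(1) b(1)] by (intro div_le_mono) simp
    then show False using a b by simp
  qed
qed

section \<open>The dictionary\<close>

text \<open>Here \<open>e\<close> is the number of elements that do not begin a run; it depends on
  \<open>S\<close>, determines the lengths of the later parts, and is stored first. Then follow the
  trailing bits, the \<open>n - e\<close> leading parts, the \<open>n - e\<close> run starts, a
  table for the other elements and a table for the later chunks. For \<open>s = 0\<close> all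
  leading parts differ, so \<open>e = 0\<close>.\<close>

lemma dictionary_exists:
  fixes m n l s lam M t :: nat and bD bR b1 b2 :: "nat \<Rightarrow> nat"
  defines "k \<equiv> 2 ^ (4 * l)"
  assumes l: "0 < l" and m: "m \<le> 2 ^ k" and M: "m \<le> M * 2 ^ s" and s: "s \<le> k"
    and lam: "n < 2 ^ lam" "lam \<le> k"
    and D: "\<And>e. e \<le> n \<Longrightarrow> rank_select k t M (n - e) (bD e)"
    and R: "\<And>e. e \<le> n \<Longrightarrow> rank_select k t n (n - e) (bR e)"
    and ret1: "\<And>e. e \<le> n \<Longrightarrow> retrieval k 34 {..<m} e (10 * l) (b1 e)"
    and ret2: "\<And>e. e \<le> n \<Longrightarrow> retrieval k 34 ({..k} \<times> {..<m}) (e div k) k (b2 e)"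
  obtains enc rk sel where "\<And>x. probes k (6 * t + 80) (rk x)" "\<And>i. probes k (6 * t + 80) (sel i)"
    "\<And>S. S \<subseteq> {..<m} \<Longrightarrow> card S = n \<Longrightarrow>
       \<exists>e\<le>n. (s = 0 \<longrightarrow> e = 0) \<and> length (enc S) = lam + n * s + bD e + bR e + b1 e + b2 e"
    "\<And>S x. S \<subseteq> {..<m} \<Longrightarrow> card S = n \<Longrightarrow> x < m \<Longrightarrow> rk x (list_memory (enc S)) = set_rank x S"
    "\<And>S i. S \<subseteq> {..<m} \<Longrightarrow> card S = n \<Longrightarrow> i < n \<Longrightarrow> sel i (list_memory (enc S)) = sorted_list_of_set S ! i"
proof -
  have k0: "0 < k" by (simp add: k_def)
  have "\<exists>enc R Z. e \<le> n \<longrightarrow> rank_select_by k t M (n - e) (bD e) enc R Z" for e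
    using D[of e] unfolding rank_select_def by blast
  then obtain encD RD ZD where D: "\<And>e. e \<le> n \<Longrightarrow> rank_select_by k t M (n - e) (bD e) (encD e) (RD e) (ZD e)"
    by metis
  have "\<exists>enc R Z. e \<le> n \<longrightarrow> rank_select_by k t n (n - e) (bR e) enc R Z" for e
    using R[of e] unfolding rank_select_def by blast
  then obtain encR RR ZR where R: "\<And>e. e \<le> n \<Longrightarrow> rank_select_by k t n (n - e) (bR e) (encR e) (RR e) (ZR e)"
    by metis
  have "\<exists>enc g. e \<le> n \<longrightarrow> retrieval_by k 34 {..<m} e (10 * l) (b1 e) enc g" for e
    using ret1[of e] unfolding retrieval_def by blast
  then obtain enc1 get1 where G1: "\<And>e. e \<le> n \<Longrightarrow> retrieval_by k 34 {..<m} e (10 * l) (b1 e) (enc1 e) (get1 e)"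
    by metis
  have "\<exists>enc g. e \<le> n \<longrightarrow> retrieval_by k 34 ({..k} \<times> {..<m}) (e div k) k (b2 e) enc g" for e
    using ret2[of e] unfolding retrieval_def by blast
  then obtain enc2 get2 where G2: "\<And>e. e \<le> n \<Longrightarrow>
      retrieval_by k 34 ({..k} \<times> {..<m}) (e div k) k (b2 e) (enc2 e) (get2 e)"
    by metis
  define oD where "oD = lam + n * s"
  define oR where "oR e = oD + bD e" for e
  define o1 where "o1 e = oR e + bR e" for e
  define o2 where "o2 e = o1 e + b1 e" for e
  \<comment> \<open>The radix that packs a prefix shift and an offset in a chunk into one value of
    \<open>10 * l\<close> bits.\<close>
  define w where "w = (2::nat) ^ (5 * l)"
  \<comment> \<open>The number \<open>c\<close> of run starts up to \<open>i\<close> identifies the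
    run, hence the leading part; the array adds the trailing bits.\<close>
  define sel' where "sel' e i mem = (let c = RR e i (shifted (oR e) mem) in
     (let h = ZD e (c - 1) (shifted oD mem) in
     (let y = read_nat (lam + i * s) s mem in h * 2 ^ s + y)))" for e i mem
  \<comment> \<open>Two candidates are tried: the start \<open>a\<close> of the run, and the
    position computed from the tables. Each is confirmed by a select query, so arbitrary table
    answers for \<open>x\<close> outside \<open>S\<close> do no harm.\<close>
  define rk' where "rk' e x mem = (let c = RD e (x div 2 ^ s) (shifted oD mem) in
     (let a = ZR e (c - 1) (shifted (oR e) mem) in
     (let y = sel' e a mem in
     (if a < n \<and> y = x then int a else
     (let v = get1 e x (shifted (o1 e) mem) in
     (let z = (if v mod w = 0 then a else get2 e (v mod w - 1, x div 2 ^ (v mod w - 1)) (shifted (o2 e) mem)) in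
     (let y' = sel' e (z + v div w) mem in
     (if z + v div w < n \<and> y' = x then int (z + v div w) else -1))))))))" for e x mem
  \<comment> \<open>The cap at \<open>n\<close> keeps the number that is read in the range where
    structures exist, so that the probe bound holds for every memory.\<close>
  define sel where "sel i mem = (let v = read_nat 0 lam mem in sel' (min v n) i mem)" for i mem
  define rk where "rk x mem = (let v = read_nat 0 lam mem in rk' (min v n) x mem)" for x mem
  have p_RD: "probes k t (\<lambda>mem. RD e x (shifted a mem))" "probes k t (\<lambda>mem. ZD e x (shifted a mem))"
    "probes k t (\<lambda>mem. RR e x (shifted a mem))" "probes k t (\<lambda>mem. ZR e x (shifted a mem))"
    if "e \<le> n" for e x a
    by (rule probes_shifted rank_select_byD(1,2)[OF D[OF that]] rank_select_byD(1,2)[OF R[OF that]])+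
  have p_get: "probes k 34 (\<lambda>mem. get1 e x (shifted a mem))" "probes k 34 (\<lambda>mem. get2 e y (shifted a mem))"
    if "e \<le> n" for e x y a
    by (rule probes_shifted retrieval_byD(1)[OF G1[OF that]] retrieval_byD(1)[OF G2[OF that]])+
  have p_sel': "probes k (t + (t + (1 + 0))) (sel' e i)" if e: "e \<le> n" for e i
    unfolding sel'_def using s
    by (intro probes_Let p_RD[OF e] probes_read_nat probes_const) simp
  have p_rk': "probes k (t + (t + ((t + (t + (1 + 0))) + (34 + (34 + ((t + (t + (1 + 0))) + 0)))))) (rk' e x)" if e: "e \<le> n" for e x
    unfolding rk'_def
    by (intro probes_Let probes_if p_sel'[OF e] p_RD[OF e] p_get[OF e] probes_const)
  have plam: "probes k 1 (read_nat 0 lam)" using lam(2) by (intro probes_read_nat) simp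
  define ix where "ix S x = card {y \<in> S. y < x}" for S :: "nat set" and x
  define hi where "hi S i = sorted_list_of_set S ! i div 2 ^ s" for S :: "nat set" and i
  define DD where "DD S = hi S ` {..<n}" for S
  define RS where "RS S = run_sequence.starts (hi S) n" for S
  define ch where "ch S = run_sequence.chunk (hi S) k" for S
  define st where "st S = run_sequence.start (hi S)" for S
  define off where "off S = run_sequence.offset (hi S)" for S
  \<comment> \<open>\<open>XX\<close> holds the keys of the first table. \<open>A S z\<close> is the
    chunk that begins at position \<open>z\<close>, \<open>ZZ\<close> the set of the first positions
    of later chunks; \<open>key\<close> names such a chunk in the second table by its common
    prefix.\<close>
  define XX where "XX S = (!) (sorted_list_of_set S) ` ({..<n} - RS S)" for S
  define A where "A S z = (!) (sorted_list_of_set S) ` {i. i < n \<and> ch S i = z}" for S z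
  define ps where "ps S z = prefix_shift (A S z)" for S z
  define ZZ where "ZZ S = {i. i < n \<and> 0 < off S i \<and> k dvd off S i}" for S
  define key where "key S z = (ps S z, sorted_list_of_set S ! z div 2 ^ ps S z)" for S z
  \<comment> \<open>The residue of the stored value modulo \<open>w\<close> is \<open>0\<close> for the first chunk of a run, whose position the
    run start already gives, and otherwise one more than the length of the discarded suffix.\<close>
  define v1 where "v1 S x = (let i = ix S x in
     (if ch S i = st S i then 0 else Suc (ps S (ch S i))) + w * (off S i mod k))" for S x
  define v2 where "v2 S = inv_into (ZZ S) (key S)" for S
  define ee where "ee S = n - card (DD S)" for S
  define enc where "enc S = nat_bits lam (ee S) @ array_bits s n (\<lambda>i. sorted_list_of_set S ! i mod 2 ^ s) @
     encD (ee S) (DD S) @ encR (ee S) (RS S) @ enc1 (ee S) (XX S) (v1 S) @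
     enc2 (ee S) (key S ` ZZ S) (v2 S)" for S
  have main: "ee S \<le> n" "s = 0 \<longrightarrow> ee S = 0"
      "length (enc S) = lam + n * s + bD (ee S) + bR (ee S) + b1 (ee S) + b2 (ee S)"
      "\<And>x. x < m \<Longrightarrow> rk x (list_memory (enc S)) = set_rank x S"
      "\<And>i. i < n \<Longrightarrow> sel i (list_memory (enc S)) = sorted_list_of_set S ! i"
    if S: "S \<subseteq> {..<m}" "card S = n" for S
  proof -
    let ?x = "\<lambda>i. sorted_list_of_set S ! i" and ?e = "ee S"
    have fS: "finite S" using S finite_subset by blast
    have x_mem: "?x i \<in> S" if "i < n" for i using nth_sorted_mem[OF fS] that S(2) by simp
    have x_lt: "?x i < m" if "i < n" for i using x_mem[OF that] S(1) by auto
    have x_less: "?x i < ?x j" if "i < j" "j < n" for i j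
      using sorted_wrt_nth_less[OF strict_sorted_list_of_set[of S] that(1)] that(2) S(2) by simp
    have x_inj: "inj_on ?x {..<n}" using x_less by (intro linorder_inj_onI) (auto simp: less_le)
    have ix_x: "ix S (?x i) = i" if "i < n" for i
      using card_less_nth_sorted[OF fS] that S(2) by (simp add: ix_def)
    have x_ix: "ix S x < n" "?x (ix S x) = x" if "x \<in> S" for x
    proof -
      show "?x (ix S x) = x" using nth_sorted_eqI[OF fS that refl] by (simp add: ix_def)
      have "{y \<in> S. y < x} \<subset> S" using that by auto
      then show "ix S x < n" using psubset_card_mono[OF fS] S(2) by (simp add: ix_def)
    qed
    interpret run_sequence "hi S" n k
    proof
      show "hi S i \<le> hi S j" if "i \<le> j" "j < n" for i j
        using x_less[of i j] that unfolding hi_def by (cases "i = j") (auto intro: div_le_mono)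
    qed (rule k0)
    note defs = RS_def ch_def st_def off_def
    have cD: "card (DD S) \<le> n" unfolding DD_def by (rule order_trans[OF card_image_le]) auto
    show e: "?e \<le> n" by (simp add: ee_def)
    have ne: "n - ?e = card (DD S)" using cD by (simp add: ee_def)
    have cR: "card (RS S) = n - ?e" unfolding ne DD_def RS_def by (rule card_starts)
    have RSn: "RS S \<subseteq> {..<n}" by (auto simp: RS_def starts_def)
    have DM: "DD S \<subseteq> {..<M}"
    proof
      fix h assume "h \<in> DD S"
      then obtain i where "i < n" "h = ?x i div 2 ^ s" by (auto simp: DD_def hi_def)
      then show "h \<in> {..<M}" using x_lt[of i] M by (simp add: less_mult_imp_div_less)
    qed
    have fD: "finite (DD S)" using DM finite_subset by blast
    have fR: "finite (RS S)" using RSn finite_subset by blast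
    show "s = 0 \<longrightarrow> ?e = 0"
    proof
      assume "s = 0"
      then have "DD S = ?x ` {..<n}" by (simp add: DD_def hi_def)
      then show "?e = 0" using x_inj by (simp add: ee_def card_image)
    qed
    have XXm: "XX S \<subseteq> {..<m}" using x_lt by (auto simp: XX_def)
    have "card (XX S) = card ({..<n} - RS S)"
      unfolding XX_def by (rule card_image) (rule inj_on_subset[OF x_inj], auto)
    also have nRS: "\<dots> = ?e" using RSn fR cR e by (subst card_Diff_subset) auto
    finally have cX: "card (XX S) \<le> ?e" by simp
    \<comment> \<open>A prefix shift is at most \<open>k\<close>, so the residue stored for it is at
      most \<open>k + 1\<close>, below \<open>w\<close>.\<close>
    have kw: "k + 2 \<le> w" "k \<le> w" "w * w = 2 ^ (10 * l)"
    proof -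
      have "(2::nat) ^ (4 * l) * 2 ^ 1 \<le> 2 ^ (4 * l) * 2 ^ l" using l by (intro mult_le_mono2 power_increasing) auto
      also have "\<dots> = w" by (simp add: w_def flip: power_add)
      finally have "k * 2 \<le> w" by (simp add: k_def)
      moreover have "(2::nat) ^ 1 \<le> k" unfolding k_def using l by (intro power_increasing) auto
      ultimately show "k + 2 \<le> w" "k \<le> w" by simp_all
      show "w * w = 2 ^ (10 * l)" by (simp add: w_def flip: power_add)
    qed
    have xk: "?x i < 2 ^ k" if "i < n" for i using x_lt[OF that] m by simp
    have Ak: "a < 2 ^ k" if "a \<in> A S z" for a z using that xk by (auto simp: A_def)
    have psk: "ps S z \<le> k" for z unfolding ps_def by (rule prefix_shift(1)) (rule Ak)
    have v1w: "v1 S x < 2 ^ (10 * l)" for x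
    proof -
      have o: "off S (ix S x) mod k < w" using k0 kw(2) by (meson less_le_trans mod_less_divisor)
      have "v1 S x < w + w * (off S (ix S x) mod k)"
        using psk[of "ch S (ix S x)"] kw(1) by (auto simp: v1_def Let_def)
      also have "\<dots> = w * Suc (off S (ix S x) mod k)" by simp
      also have "\<dots> \<le> w * w" using o by (intro mult_le_mono2) simp
      finally show ?thesis by (simp add: kw)
    qed
    have v1_mod: "v1 S x mod w = (if ch S (ix S x) = st S (ix S x) then 0 else Suc (ps S (ch S (ix S x))))"
      "v1 S x div w = off S (ix S x) mod k" for x
      using psk[of "ch S (ix S x)"] kw(1) by (auto simp: v1_def Let_def)
    have ch_ZZ: "ch S z = z" if "z \<in> ZZ S" for z
      using that start(2)[of z] by (auto simp: ZZ_def defs chunk_def offset_def)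
    \<comment> \<open>Chunks are ordered like their first positions, so of two different chunks one
      lies entirely below the other, and their common prefixes differ.\<close>
    have key_inj: "inj_on (key S) (ZZ S)"
    proof (rule linorder_inj_onI)
      fix z z' assume z: "z < z'" "z \<in> ZZ S" "z' \<in> ZZ S"
      have less: "a < b" if ab: "a \<in> A S z" "b \<in> A S z'" for a b
      proof -
        obtain i j where ij: "i < n" "ch S i = z" "a = ?x i" "j < n" "ch S j = z'" "b = ?x j"
          using ab by (auto simp: A_def)
        have "i < j"
        proof (rule ccontr)
          assume "\<not> i < j"
          then have "ch S j \<le> ch S i" unfolding ch_def using ij by (intro chunk_mono) auto
          then show False using ij z by simp
        qed
        then show ?thesis using x_less ij by simp
      qed
      have "?x z \<in> A S z" "?x z' \<in> A S z'" using ch_ZZ z by (auto simp: A_def ZZ_def)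
      then show "key S z \<noteq> key S z'"
        using prefix_distinct[of "A S z" k "A S z'" "?x z" "?x z'", OF Ak Ak less]
        by (auto simp: key_def ps_def)
    qed auto
    have keyU: "key S ` ZZ S \<subseteq> {..k} \<times> {..<m}"
      using psk x_lt by (auto simp: key_def ZZ_def intro: le_less_trans[OF div_le_dividend])
    have "k * card (ZZ S) \<le> ?e"
      using card_later_chunks nRS by (simp add: ZZ_def defs)
    then have "card (ZZ S) \<le> ?e div k" using k0 by (simp add: less_eq_div_iff_mult_less_eq mult.commute)
    then have cK: "card (key S ` ZZ S) \<le> ?e div k"
      using card_image[OF key_inj] by simp
    have v2k: "v2 S p < 2 ^ k" if "p \<in> key S ` ZZ S" for p
    proof -
      have "v2 S p < n" using inv_into_into[OF that] by (simp add: v2_def ZZ_def)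
      also have "n \<le> m" using card_mono[OF _ S(1)] S(2) by simp
      finally show ?thesis using m by simp
    qed
    have len: "length (encD ?e (DD S)) = bD ?e" "length (encR ?e (RS S)) = bR ?e"
      "length (enc1 ?e (XX S) (v1 S)) = b1 ?e" "length (enc2 ?e (key S ` ZZ S) (v2 S)) = b2 ?e"
      by (rule rank_select_byD(3)[OF D[OF e] DM ne[symmetric]] rank_select_byD(3)[OF R[OF e] RSn cR]
          retrieval_byD(2)[where v = "v1 S", OF G1[OF e] XXm cX v1w] retrieval_byD(2)[where v = "v2 S", OF G2[OF e] keyU cK v2k], assumption?)+
    show "length (enc S) = lam + n * s + bD ?e + bR ?e + b1 ?e + b2 ?e"
      by (simp add: enc_def len)
    let ?m = "list_memory (enc S)"
    have con: "contains ?m 0 (nat_bits lam ?e)" "contains ?m lam (array_bits s n (\<lambda>i. ?x i mod 2 ^ s))"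
      "contains (shifted oD ?m) 0 (encD ?e (DD S))" "contains (shifted (oR ?e) ?m) 0 (encR ?e (RS S))"
      "contains (shifted (o1 ?e) ?m) 0 (enc1 ?e (XX S) (v1 S))"
      "contains (shifted (o2 ?e) ?m) 0 (enc2 ?e (key S ` ZZ S) (v2 S))"
      using contains_list_memory[of "enc S"]
      by (simp_all add: enc_def contains_append len contains_shifted oD_def oR_def o1_def o2_def add.assoc)
    have rd_e: "min (read_nat 0 lam ?m) n = ?e"
      using read_nat_contains[OF con(1)] e lam(1) by simp
    have RD: "RD ?e h (shifted oD ?m) = card {y \<in> DD S. y \<le> h}" if "h < M" for h
      by (rule rank_select_byD(4)[OF D[OF e] DM ne[symmetric] con(3) that])
    have ZD: "ZD ?e i (shifted oD ?m) = sorted_list_of_set (DD S) ! i" if "i < n - ?e" for i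
      by (rule rank_select_byD(5)[OF D[OF e] DM ne[symmetric] con(3) that])
    have RR: "RR ?e i (shifted (oR ?e) ?m) = card {y \<in> RS S. y \<le> i}" if "i < n" for i
      by (rule rank_select_byD(4)[OF R[OF e] RSn cR con(4) that])
    have ZR: "ZR ?e i (shifted (oR ?e) ?m) = sorted_list_of_set (RS S) ! i" if "i < n - ?e" for i
      by (rule rank_select_byD(5)[OF R[OF e] RSn cR con(4) that])
    have cards: "card {y \<in> RS S. y \<le> i} = card {y \<in> DD S. y \<le> hi S i}"
      "card {y \<in> RS S. y \<le> i} - 1 < n - ?e"
      "sorted_list_of_set (DD S) ! (card {y \<in> RS S. y \<le> i} - 1) = hi S i"
      "sorted_list_of_set (RS S) ! (card {y \<in> RS S. y \<le> i} - 1) = st S i" if i: "i < n" for i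
    proof -
      show c: "card {y \<in> RS S. y \<le> i} = card {y \<in> DD S. y \<le> hi S i}"
        unfolding RS_def DD_def by (rule card_starts_le[OF i])
      have hD: "hi S i \<in> DD S" using i by (simp add: DD_def)
      show "card {y \<in> RS S. y \<le> i} - 1 < n - ?e"
        unfolding ne c using nth_sorted_rank(2,3)[OF fD hD] by linarith
      show "sorted_list_of_set (DD S) ! (card {y \<in> RS S. y \<le> i} - 1) = hi S i"
        unfolding c by (rule nth_sorted_rank(1)[OF fD hD])
      show "sorted_list_of_set (RS S) ! (card {y \<in> RS S. y \<le> i} - 1) = st S i"
        using nth_sorted_rank(1)[OF fR, of "st S i"] start_in[OF i] starts_le_eq[OF i]
        by (simp add: RS_def st_def)
    qed
    have sel': "sel' ?e i ?m = ?x i" if i: "i < n" for i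
      using RR[OF i] ZD[OF cards(2)[OF i]] cards(3)[OF i] read_array[OF con(2) i]
        div_mult_mod_eq[of "?x i" "2 ^ s"]
      by (simp add: sel'_def Let_def hi_def)
    show "sel i ?m = ?x i" if "i < n" for i
      using sel'[OF that] rd_e by (simp add: sel_def Let_def)
    fix x assume x: "x < m"
    show "rk x ?m = set_rank x S"
    proof -
      let ?c = "RD ?e (x div 2 ^ s) (shifted oD ?m)"
      let ?a = "ZR ?e (?c - 1) (shifted (oR ?e) ?m)"
      let ?v = "get1 ?e x (shifted (o1 ?e) ?m)"
      let ?z = "if ?v mod w = 0 then ?a else get2 ?e (?v mod w - 1, x div 2 ^ (?v mod w - 1)) (shifted (o2 ?e) ?m)"
      let ?p = "?z + ?v div w"
      have rk: "rk x ?m = (if ?a < n \<and> sel' ?e ?a ?m = x then int ?a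
          else if ?p < n \<and> sel' ?e ?p ?m = x then int ?p else -1)"
        by (simp add: rk_def rk'_def Let_def rd_e)
      \<comment> \<open>Only the true position of \<open>x\<close> can pass the check.\<close>
      have sound: "x \<in> S \<and> ix S x = i" if "i < n" "sel' ?e i ?m = x" for i
        using that sel'[OF that(1)] x_mem[OF that(1)] ix_x[OF that(1)] by auto
      show ?thesis
      proof (cases "x \<in> S")
        case False
        then show ?thesis using sound by (auto simp: rk set_rank_def)
      next
        case True
        let ?i = "ix S x"
        have i: "?i < n" "?x ?i = x" using x_ix[OF True] by auto
        have h: "x div 2 ^ s = hi S ?i" using i by (simp add: hi_def)
        have "x div 2 ^ s < M" using x M by (simp add: less_mult_imp_div_less)
        then have c: "?c = card {y \<in> RS S. y \<le> ?i}" using RD cards(1)[OF i(1)] h by simp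
        have a: "?a = st S ?i" using c ZR[OF cards(2)[OF i(1)]] cards(4)[OF i(1)] by simp
        \<comment> \<open>The first candidate is right if \<open>x\<close> begins its run; otherwise
          the tables supply the chunk and the offset in it.\<close>
        have found: "?a = ?i \<or> ?p = ?i"
        proof (cases "?i \<in> RS S")
          case True
          then show ?thesis using a start_eq_iff[OF i(1)] by (simp add: defs)
        next
          case nR: False
          have "?x ?i \<in> XX S" unfolding XX_def using i(1) nR by (intro imageI) simp
          then have "x \<in> XX S" by (simp only: i(2))
          then have v: "?v = v1 S x" by (rule retrieval_byD(3)[where v = "v1 S", OF G1[OF e] XXm cX v1w con(5)])
          have "?z = ch S ?i"
          proof (cases "ch S ?i = st S ?i")
            case True
            then show ?thesis using v v1_mod(1)[of x] a by simp
          next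
            case ne': False
            have vm: "?v mod w = Suc (ps S (ch S ?i))" using v v1_mod(1)[of x] ne' by simp
            have ci: "chunk ?i < n" using chunk_le(1)[of ?i] i(1) by linarith
            have z: "ch S ?i \<in> ZZ S"
              using chunk_chunk(2)[OF i(1)] ci ne' by (auto simp: ZZ_def defs chunk_def[of ?i])
            have "?x (ch S ?i) \<in> A S (ch S ?i)" "?x ?i \<in> A S (ch S ?i)"
              using ch_ZZ[OF z] ci i(1) by (auto simp: A_def ch_def)
            \<comment> \<open>\<open>x\<close> and the first element of its chunk share the prefix,
              so the key is computable from \<open>x\<close> and the stored shift.\<close>
            then have "?x (ch S ?i) div 2 ^ ps S (ch S ?i) = ?x ?i div 2 ^ ps S (ch S ?i)"
              unfolding ps_def by (intro prefix_shift(2)[of "A S (ch S ?i)" k] Ak)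
            then have "?x (ch S ?i) div 2 ^ ps S (ch S ?i) = x div 2 ^ ps S (ch S ?i)" by (simp only: i(2))
            then have key: "(?v mod w - 1, x div 2 ^ (?v mod w - 1)) = key S (ch S ?i)"
              by (simp add: vm key_def)
            have "get2 ?e (key S (ch S ?i)) (shifted (o2 ?e) ?m) = v2 S (key S (ch S ?i))"
              by (rule retrieval_byD(3)[where v = "v2 S", OF G2[OF e] keyU cK v2k con(6)]) (use z in auto)
            also have "\<dots> = ch S ?i" unfolding v2_def by (rule inv_into_f_f[OF key_inj z])
            finally show ?thesis using key vm by simp
          qed
          then have "?p = ch S ?i + off S ?i mod k" using v v1_mod(2)[of x] by simp
          also have "\<dots> = ?i" unfolding ch_def off_def by (rule chunk_le(3)[symmetric])
          finally show ?thesis by (rule disjI2)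
        qed
        have "sel' ?e ?i ?m = x" using sel'[OF i(1)] i(2) by simp
        then have "rk x ?m = int ?i" using found sound i(1) unfolding rk by (smt (verit))
        then show ?thesis using True by (simp add: set_rank_def ix_def)
      qed
    qed
  qed
  show ?thesis
  proof (rule that[of rk sel enc])
    have "probes k (1 + (t + (t + ((t + (t + (1 + 0))) + (34 + (34 + ((t + (t + (1 + 0))) + 0))))))) (rk x)" for x
      unfolding rk_def by (intro probes_Let plam p_rk') simp
    then show "probes k (6 * t + 80) (rk x)" for x by (rule probes_mono) simp
    have "probes k (1 + (t + (t + (1 + 0)))) (sel i)" for i
      unfolding sel_def by (intro probes_Let plam p_sel') simp
    then show "probes k (6 * t + 80) (sel i)" for i by (rule probes_mono) simp
    show "\<exists>e\<le>n. (s = 0 \<longrightarrow> e = 0) \<and> length (enc S) = lam + n * s + bD e + bR e + b1 e + b2 e"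
      if "S \<subseteq> {..<m}" "card S = n" for S
      by (rule exI[of _ "ee S"]) (simp add: main[OF that])
  qed (simp_all add: main)
qed

section \<open>Space accounting\<close>

lemma Suc_times_binomial_Suc: "Suc n * (M choose Suc n) = (M choose n) * (M - n)"
  by (simp only: binomial_absorption binomial_absorb_comp mult.commute[of "M choose n"])

text \<open>Apart from rounding, distinct leading parts with arbitrary trailing bits form a subset
  of \<open>[m]\<close>. Rounding \<open>M\<close> up costs a factor 2 in the first factor of the
  binomial coefficient only.\<close>

lemma binomial_shift_le:
  fixes M m s n :: nat
  assumes "M * 2 ^ s \<le> m + 2 ^ s - 1" "2 ^ s \<le> m"
  shows "(M choose n) * 2 ^ (s * n) \<le> 2 * (m choose n)"
proof (induction n)
  case (Suc n)
  show ?case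
  proof (cases n)
    case 0
    have "M * 2 ^ s \<le> 2 * m" using assms by linarith
    then show ?thesis using 0 by simp
  next
    case (Suc n')
    \<comment> \<open>From the second factor on, the excess of at most \<open>2 ^ s - 1\<close> is
      compensated by the elements already chosen.\<close>
    have le: "(M - n) * 2 ^ s \<le> m - n"
    proof (cases "n \<le> M")
      case True
      have "n' * 1 \<le> n' * (2::nat) ^ s" by (intro mult_le_mono2) simp
      moreover have "(M - n) * 2 ^ s + n * 2 ^ s = M * 2 ^ s"
        using True by (simp flip: add_mult_distrib)
      moreover have "n * 2 ^ s = 2 ^ s + n' * 2 ^ s" using Suc by simp
      moreover have "1 \<le> (2::nat) ^ s" by simp
      ultimately show ?thesis using assms(1) Suc by linarith
    qed simp
    have "Suc n * ((M choose Suc n) * 2 ^ (s * Suc n)) = ((M choose n) * 2 ^ (s * n)) * ((M - n) * 2 ^ s)"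
      using arg_cong[OF Suc_times_binomial_Suc[of n M], of "\<lambda>x. x * (2 ^ (s * n) * 2 ^ s)"]
      by (simp only: power_add mult_Suc_right ac_simps)
    also have "\<dots> \<le> (2 * (m choose n)) * (m - n)" using Suc.IH le by (rule mult_le_mono)
    also have "\<dots> = Suc n * (2 * (m choose Suc n))"
      using Suc_times_binomial_Suc[of n m] by (simp only: ac_simps)
    finally show ?thesis by (simp only: mult_le_cancel1 zero_less_Suc simp_thms)
  qed
qed simp

text \<open>For \<open>d < n\<close> the ratio of \<open>M choose Suc d\<close> to
  \<open>M choose d\<close> is \<open>(M - d) / Suc d\<close>, at least \<open>y\<close>.\<close>

lemma binomial_fewer_le:
  fixes M n y e :: nat
  assumes "n + n * y \<le> M" "e \<le> n"
  shows "(M choose (n - e)) * y ^ e \<le> (M choose n)"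
  using assms(2)
proof (induction e)
  case (Suc e)
  let ?d = "n - Suc e"
  have d: "n - e = Suc ?d" using Suc.prems by simp
  have "Suc ?d * y \<le> M - ?d"
  proof -
    have "Suc ?d * y \<le> n * y" using Suc.prems by (intro mult_le_mono1) simp
    then show ?thesis using assms(1) by simp
  qed
  then have "(M choose ?d) * (Suc ?d * y) \<le> (M choose ?d) * (M - ?d)" by (rule mult_le_mono2)
  also have "\<dots> = Suc ?d * (M choose Suc ?d)"
    by (rule Suc_times_binomial_Suc[symmetric])
  finally have "Suc ?d * ((M choose ?d) * y) \<le> Suc ?d * (M choose Suc ?d)" by (simp only: ac_simps)
  then have "(M choose ?d) * y \<le> (M choose Suc ?d)" by (simp only: mult_le_cancel1 zero_less_Suc simp_thms)
  then have "(M choose ?d) * y * y ^ e \<le> (M choose (n - e)) * y ^ e" unfolding d by (rule mult_le_mono1)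
  also have "\<dots> \<le> (M choose n)" using Suc by simp
  finally show ?case by (simp only: power_Suc ac_simps)
qed simp

text \<open>One term of the binomial expansion of \<open>(1 + 1 / k) ^ n\<close> is at most the
  whole.\<close>

lemma log_binomial_le:
  fixes k n e :: nat
  assumes "e \<le> n" "0 < k"
  shows "log 2 (real (n choose e)) \<le> real e * log 2 (real k) + 2 * real n / real k"
proof -
  let ?y = "1 / real k"
  have "real (n choose e) * ?y ^ e \<le> (\<Sum>i\<le>n. real (n choose i) * ?y ^ i)"
    using assms(1) by (intro member_le_sum) auto
  also have "\<dots> = (1 + ?y) ^ n" using binomial_ring[of ?y 1 n] by (simp add: add.commute)
  finally have "real (n choose e) \<le> (1 + ?y) ^ n * real k ^ e"
    using assms(2) by (simp add: field_simps)
  moreover have "0 < real (n choose e)" using zero_less_binomial[OF assms(1)] by simp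
  ultimately have "log 2 (real (n choose e)) \<le> log 2 ((1 + ?y) ^ n * real k ^ e)"
    by (intro log_mono) auto
  also have "\<dots> = real n * log 2 (1 + ?y) + real e * log 2 (real k)"
  proof -
    have "0 < 1 + ?y" by (simp add: add_pos_nonneg)
    then show ?thesis using assms(2) by (simp add: log_mult log_nat_power)
  qed
  also have "real n * log 2 (1 + ?y) \<le> real n * (2 * ?y)"
  proof -
    have "ln (1 + ?y) \<le> ?y" by (rule ln_add_one_self_le_self) simp
    also have "?y \<le> 2 * ?y * ln 2"
    proof -
      have "1 \<le> ln (2 ^ 2 :: real)" using exp_le by (subst ln_ge_iff) auto
      also have "\<dots> = 2 * ln 2" by (subst ln_realpow) auto
      finally have "?y * 1 \<le> ?y * (2 * ln 2)" by (intro mult_left_mono) auto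
      then show ?thesis by simp
    qed
    finally have "log 2 (1 + ?y) \<le> 2 * ?y" by (simp add: log_def field_simps)
    then show ?thesis by (intro mult_left_mono) auto
  qed
  finally show ?thesis by (simp add: algebra_simps)
qed

text \<open>The term \<open>780 * e * l\<close> is the size of the hashing part, and \<open>n choose e\<close> costs another \<open>4 * e * l\<close>
  bits; the exponent \<open>785 * l\<close> of the universe of leading parts is chosen to absorb both.\<close>

lemma space_bound:
  fixes M m n e s l :: nat
  assumes "n \<le> m" "e \<le> n" "0 < l"
    and "s = 0 \<Longrightarrow> e = 0 \<and> M = m"
    and "0 < s \<Longrightarrow> n * 2 ^ (785 * l) \<le> M \<and> M * 2 ^ s \<le> m + 2 ^ s - 1 \<and> 2 ^ s \<le> m"
  shows "log 2 (real (M choose (n - e))) + log 2 (real (n choose (n - e))) + real (n * s) + 780 * real (e * l)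
     \<le> log 2 (real (m choose n)) + 1 + 2 * real n / 2 ^ (4 * l)"
proof (cases "s = 0")
  case True
  then show ?thesis using assms(4) by simp
next
  case False
  have M: "n * 2 ^ (785 * l) \<le> M" "M * 2 ^ s \<le> m + 2 ^ s - 1" "2 ^ s \<le> m" using assms(5) False by auto
  have nM: "n \<le> M" using M(1) by (metis le_trans mult.right_neutral mult_le_mono2 one_le_numeral one_le_power)
  \<comment> \<open>One factor \<open>2 ^ l\<close> pays for the summand \<open>n\<close>; the
    remaining exponent is \<open>784 = 780 + 4\<close>.\<close>
  have "n + n * 2 ^ (784 * l) \<le> M"
  proof -
    have "(1::nat) \<le> 2 ^ (784 * l)" by simp
    then have "(1::nat) + 2 ^ (784 * l) \<le> 2 ^ (784 * l) * 2 ^ 1" by simp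
    also have "\<dots> \<le> 2 ^ (784 * l) * 2 ^ l" using assms(3) by (intro mult_le_mono2 power_increasing) auto
    also have "\<dots> = 2 ^ (785 * l)" by (simp flip: power_add)
    finally have "n * (1 + 2 ^ (784 * l)) \<le> n * 2 ^ (785 * l)" by (rule mult_le_mono2)
    then show ?thesis using M(1) by simp
  qed
  from binomial_fewer_le[OF this assms(2)]
  have "(M choose (n - e)) * 2 ^ (784 * l * e) \<le> (M choose n)" by (simp add: power_mult)
  then have "(M choose (n - e)) * 2 ^ (784 * l * e) * 2 ^ (s * n) \<le> (M choose n) * 2 ^ (s * n)"
    by (rule mult_le_mono1)
  also have "\<dots> \<le> 2 * (m choose n)" by (rule binomial_shift_le[OF M(2,3)])
  finally have "real ((M choose (n - e)) * 2 ^ (784 * l * e) * 2 ^ (s * n)) \<le> real (2 * (m choose n))"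
    by (rule of_nat_mono)
  moreover have pos: "0 < M choose (n - e)" "0 < m choose n" using nM assms(1) by (simp_all add: zero_less_binomial)
  ultimately have "log 2 (real (M choose (n - e)) * 2 ^ (784 * l * e) * 2 ^ (s * n)) \<le> log 2 (2 * real (m choose n))"
    by (subst log_le_cancel_iff) simp_all
  moreover have "log 2 (real (M choose (n - e)) * 2 ^ (784 * l * e) * 2 ^ (s * n))
     = log 2 (real (M choose (n - e))) + real (784 * l * e) + real (s * n)"
    using pos(1) by (simp add: log_mult log_nat_power del: of_nat_mult)
  moreover have "log 2 (2 * real (m choose n)) = 1 + log 2 (real (m choose n))"
    using pos(2) by (simp add: log_mult)
  moreover have "log 2 (real (n choose (n - e))) \<le> real e * real (4 * l) + 2 * real n / 2 ^ (4 * l)"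
    using log_binomial_le[OF assms(2), of "2 ^ (4 * l)"] assms(2)
    by (simp add: binomial_symmetric[symmetric] log_nat_power)
  ultimately show ?thesis by (simp add: algebra_simps)
qed

text \<open>If \<open>m\<close> is at least \<open>N\<close>, then \<open>s\<close> is the largest
  shift with \<open>2 ^ s * N \<le> m\<close>, and \<open>M\<close> is \<open>m / 2 ^ s\<close>
  rounded up.\<close>

lemma quotient_exists:
  fixes N m :: nat
  assumes "0 < N" "0 < m"
  obtains s M where "m \<le> M * 2 ^ s" "M * 2 ^ s \<le> m + 2 ^ s - 1" "2 ^ s \<le> m" "M \<le> 2 * N"
    "s = 0 \<Longrightarrow> M = m" "0 < s \<Longrightarrow> N \<le> M"
proof (cases "m < N")
  case True
  then show ?thesis using that[of m 0] assms by simp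
next
  case False
  then have "1 \<le> m div N" using assms(1) by (simp add: div_greater_zero_iff Suc_le_eq)
  then obtain s where s: "2 ^ s \<le> m div N" "m div N < 2 ^ (s + 1)"
    using ex_power_ivl1[of 2 "m div N"] by auto
  have lo: "2 ^ s * N \<le> m" using s(1) by (meson div_times_less_eq_dividend le_trans mult_le_mono1)
  have hi: "m < 2 ^ (s + 1) * N" using s(2) assms(1) by (simp add: div_less_iff_less_mult)
  define M where "M = (m + 2 ^ s - 1) div 2 ^ s"
  have 1: "M * 2 ^ s \<le> m + 2 ^ s - 1" by (simp add: M_def)
  have "m + 2 ^ s - 1 = M * 2 ^ s + (m + 2 ^ s - 1) mod 2 ^ s"
    unfolding M_def by (rule div_mult_mod_eq[symmetric])
  moreover have "(m + 2 ^ s - 1) mod 2 ^ s < 2 ^ s" by simp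
  moreover have one: "1 \<le> (2::nat) ^ s" by simp
  ultimately have 2: "m \<le> M * 2 ^ s" by linarith
  have "2 ^ s \<le> m" using lo assms(1) by (metis le_trans mult.right_neutral mult_le_mono2 Suc_leI One_nat_def)
  moreover have "M \<le> 2 * N"
  proof -
    have "M * 2 ^ s < (2 * N) * 2 ^ s + 2 ^ s" using 1 hi one by (simp add: ac_simps)
    then have "M * 2 ^ s < (2 * N + 1) * 2 ^ s" by simp
    then have "M < 2 * N + 1" by (simp only: mult_less_cancel2)
    then show ?thesis by simp
  qed
  moreover have "N \<le> M"
  proof -
    have "N * 2 ^ s \<le> M * 2 ^ s" using order_trans[OF lo 2] by (simp only: mult.commute)
    then show ?thesis by (simp only: mult_le_cancel2) simp
  qed
  ultimately show ?thesis using that[OF 2 1] by (simp add: M_def)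
qed

section \<open>Choice of the parameters\<close>

lemma linear_less_power: "14 \<le> l \<Longrightarrow> 797 * l < 2 ^ (l::nat)"
  by (induction l rule: dec_induct) simp_all

text \<open>With \<open>q = 2 ^ l\<close>, \<open>k = q ^ 4\<close> and \<open>g = 785\<close> the
  trees have \<open>H = 797\<close>. Each rank/select structure then takes
  \<open>19 + 2 * 797 = 1613\<close> probes, and the dictionary
  \<open>6 * 1613 + 80 = 9758\<close>.\<close>

lemma succinct_dictionary:
  fixes m n l :: nat
  defines "k \<equiv> 2 ^ (4 * l)"
  assumes l: "14 \<le> l" and m: "m < 2 ^ k" and n: "0 < n" "n \<le> m"
  obtains enc rk sel where "\<And>x. probes k 9758 (rk x)" "\<And>i. probes k 9758 (sel i)"
    "\<And>S. S \<subseteq> {..<m} \<Longrightarrow> card S = n \<Longrightarrow> real (length (enc S))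
       \<le> log 2 (real (m choose n)) + 3194 * real n / 2 ^ l + log 2 (real n + 1) + 6"
    "\<And>S x. S \<subseteq> {..<m} \<Longrightarrow> card S = n \<Longrightarrow> x < m \<Longrightarrow> rk x (list_memory (enc S)) = set_rank x S"
    "\<And>S i. S \<subseteq> {..<m} \<Longrightarrow> card S = n \<Longrightarrow> i < n \<Longrightarrow> sel i (list_memory (enc S)) = sorted_list_of_set S ! i"
proof -
  define q :: nat where "q = 2 ^ l"
  have kq: "k = q ^ 4" by (simp add: k_def q_def mult.commute flip: power_mult)
  have k0: "0 < k" by (simp add: k_def)
  have m2: "m \<le> 2 ^ k" and n2: "n \<le> 2 ^ k" using m n(2) by linarith+
  have "(2::nat) ^ 6 \<le> 2 ^ l" using l by (intro power_increasing) auto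
  then have q64: "64 \<le> q" by (simp add: q_def)
  \<comment> \<open>For \<open>q = 2 ^ l\<close> this amounts to \<open>797 * l < 2 ^ l\<close>,
    whence the bound 14 on \<open>l\<close>.\<close>
  have qH: "q ^ (785 + 12) < 2 ^ q"
  proof -
    have "q ^ (785 + 12) = 2 ^ (797 * l)" unfolding q_def by (simp add: mult.commute flip: power_mult)
    also have "\<dots> < 2 ^ q" using linear_less_power[OF l] by (intro power_strict_increasing) (auto simp: q_def)
    finally show ?thesis .
  qed
  obtain s M where sM: "m \<le> M * 2 ^ s" "M * 2 ^ s \<le> m + 2 ^ s - 1" "2 ^ s \<le> m" "M \<le> 2 * (n * 2 ^ (785 * l))"
    "s = 0 \<Longrightarrow> M = m" "0 < s \<Longrightarrow> n * 2 ^ (785 * l) \<le> M"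
  proof (rule quotient_exists[of "n * 2 ^ (785 * l)" m])
    show "0 < n * 2 ^ (785 * l)" "0 < m" using n by auto
  qed blast
  have "(2::nat) ^ s \<le> 2 ^ k" using sM(3) m2 by linarith
  then have sk: "s \<le> k" by simp
  define lam where "lam = nat \<lceil>log 2 (real n + 1)\<rceil>"
  have lpos: "0 \<le> log 2 (real n + 1)" by simp
  have "real n + 1 = 2 powr (log 2 (real n + 1))" by simp
  also have "\<dots> \<le> 2 powr real lam" by (intro powr_mono) (auto simp: lam_def intro: real_nat_ceiling_ge)
  also have "\<dots> = real (2 ^ lam)" by (simp add: powr_realpow)
  finally have nlam: "n < 2 ^ lam" by linarith
  have "real n + 1 \<le> real (2 ^ k)" using m n(2) by linarith
  then have "log 2 (real n + 1) \<le> log 2 (real (2 ^ k))" by (subst log_le_cancel_iff) auto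
  also have "\<dots> = real k" by (simp add: log_nat_power)
  finally have lamk: "lam \<le> k" unfolding lam_def by (simp add: ceiling_le_iff nat_le_iff)
  \<comment> \<open>The redundancy of one rank/select structure; \<open>1596 = 2 * 797 + 2\<close>.
    Two of them and the \<open>2 * n / 2 ^ l\<close> from \<open>n choose e\<close> make up the
    constant 3194.\<close>
  let ?E = "1596 / real q * real n"
  define bD where "bD e = nat \<lceil>log 2 (real (M choose (n - e))) + 1 + ?E\<rceil>" for e
  define bR where "bR e = nat \<lceil>log 2 (real (n choose (n - e))) + 1 + ?E\<rceil>" for e
  have q785: "q ^ 785 = 2 ^ (785 * l)" unfolding q_def by (simp add: mult.commute flip: power_mult)
  have rsD: "rank_select k 1613 M (n - e) (bD e)" for e
  proof -
    have "rank_select (q ^ 4) (19 + 2 * (785 + 12)) M (n - e) (bD e)"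
      by (rule rank_select_exists[where n = n, OF q64 qH])
         (use sM(4) n2 in \<open>auto simp: q785 kq bD_def intro: order_trans[OF _ real_nat_ceiling_ge]\<close>)
    then show ?thesis by (simp add: kq)
  qed
  have rsR: "rank_select k 1613 n (n - e) (bR e)" for e
  proof -
    have "n \<le> 3 * n * q ^ 785" using q64 by simp
    then have "rank_select (q ^ 4) (19 + 2 * (785 + 12)) n (n - e) (bR e)"
      by (intro rank_select_exists[where n = n, OF q64 qH])
         (use n2 in \<open>auto simp: kq bR_def intro: order_trans[OF _ real_nat_ceiling_ge]\<close>)
    then show ?thesis by (simp add: kq)
  qed
  have l4: "16 * l \<le> k"
  proof -
    have "16 * l \<le> 797 * l" by simp
    also have "\<dots> \<le> 2 ^ l" using linear_less_power[OF l] by simp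
    also have "\<dots> \<le> k" unfolding k_def by (intro power_increasing) auto
    finally show ?thesis .
  qed
  have "k + 1 \<le> 2 ^ k" using less_exp[of k] by linarith
  then have "(k + 1) * m \<le> 2 ^ k * 2 ^ k" using m2 by (intro mult_le_mono)
  also have "\<dots> = 2 ^ (2 * k)" by (simp add: mult_2 power_add)
  finally have cU: "card ({..k} \<times> {..<m}) \<le> 2 ^ (2 * k)" by simp
  have mm: "card {..<m} \<le> 2 ^ (2 * k)" using m2 power_increasing[of k "2 * k" "2::nat"] by (simp add: order_trans)
  have l0: "0 < l" using l by simp
  have "\<exists>b. e \<le> n \<longrightarrow> b \<le> 660 * (e * l) \<and> retrieval k 34 {..<m} e (10 * l) b" for e
  proof (cases "e \<le> n")
    case True
    obtain b where "b \<le> 60 * e * (l + 10 * l)" "retrieval k 34 {..<m} e (10 * l) b"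
      using retrieval_exists[of "{..<m}" k l e "10 * l"] mm l0 l4 True n2 by (auto simp: k_def)
    then show ?thesis by (intro exI[of _ b]) simp
  qed simp
  then obtain b1 where b1: "\<And>e. e \<le> n \<Longrightarrow> b1 e \<le> 660 * (e * l)" "\<And>e. e \<le> n \<Longrightarrow> retrieval k 34 {..<m} e (10 * l) (b1 e)"
    by metis
  \<comment> \<open>The second table has only \<open>e div k\<close> keys, so values of
    \<open>k\<close> bits cost \<open>O(e)\<close> bits in total.\<close>
  have "\<exists>b. e \<le> n \<longrightarrow> b \<le> 120 * (e * l) \<and> retrieval k 34 ({..k} \<times> {..<m}) (e div k) k b" for e
  proof (cases "e \<le> n")
    case True
    have "e div k \<le> 2 ^ k" using True n2 div_le_dividend[of e k] by linarith
    then obtain b where b: "b \<le> 60 * (e div k) * (l + k)" "retrieval k 34 ({..k} \<times> {..<m}) (e div k) k b"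
      using retrieval_exists[of "{..k} \<times> {..<m}" k l "e div k" k] cU l0 by (auto simp: k_def)
    have "60 * (e div k) * (l + k) \<le> 60 * (e div k) * (2 * k)" using l4 by (intro mult_le_mono2) simp
    also have "\<dots> = 120 * (e div k * k)" by simp
    also have "\<dots> \<le> 120 * e" by simp
    also have "\<dots> \<le> 120 * (e * l)" using l0 by simp
    finally have "b \<le> 120 * (e * l)" using b(1) by (rule order_trans[rotated])
    then show ?thesis using b(2) by blast
  qed simp
  then obtain b2 where b2: "\<And>e. e \<le> n \<Longrightarrow> b2 e \<le> 120 * (e * l)"
    "\<And>e. e \<le> n \<Longrightarrow> retrieval k 34 ({..k} \<times> {..<m}) (e div k) k (b2 e)"
    by metis
  have bound: "real (lam + n * s + bD e + bR e + b1 e + b2 e)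
      \<le> log 2 (real (m choose n)) + 3194 * real n / 2 ^ l + log 2 (real n + 1) + 6"
    if e: "e \<le> n" "s = 0 \<longrightarrow> e = 0" for e
  proof -
    have E0: "0 \<le> ?E" by simp
    have nM: "n - e \<le> M"
    proof (cases "s = 0")
      case False
      then have "n * 1 \<le> M" using sM(6) by (meson le_trans mult_le_mono2 one_le_numeral one_le_power zero_less_iff_neq_zero)
      then show ?thesis by simp
    qed (use sM(5) n in simp)
    have p: "0 \<le> log 2 (real (M choose (n - e)))" "0 \<le> log 2 (real (n choose (n - e)))"
      using zero_less_binomial[OF nM] zero_less_binomial[of "n - e" n]
      by (intro zero_le_log_cancel_iff[THEN iffD2]; linarith)+
    have "real lam \<le> log 2 (real n + 1) + 1" using lpos unfolding lam_def by linarith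
    moreover have "real (bD e) \<le> log 2 (real (M choose (n - e))) + 2 + ?E" using p E0 unfolding bD_def by linarith
    moreover have "real (bR e) \<le> log 2 (real (n choose (n - e))) + 2 + ?E" using p E0 unfolding bR_def by linarith
    moreover have "real (b1 e) + real (b2 e) \<le> 780 * real (e * l)"
    proof -
      have "b1 e + b2 e \<le> 780 * (e * l)" using b1(1)[OF e(1)] b2(1)[OF e(1)] by simp
      then have "real (b1 e + b2 e) \<le> real (780 * (e * l))" by (rule of_nat_mono)
      then show ?thesis by simp
    qed
    moreover have "log 2 (real (M choose (n - e))) + log 2 (real (n choose (n - e))) + real (n * s) + 780 * real (e * l)
        \<le> log 2 (real (m choose n)) + 1 + 2 * real n / 2 ^ (4 * l)"
      using sM e n(2) l0 by (intro space_bound) auto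
    moreover have "2 * real n / 2 ^ (4 * l) \<le> 2 * real n / 2 ^ l"
      by (intro divide_left_mono power_increasing) auto
    moreover have "3194 * real n / 2 ^ l = 2 * ?E + 2 * real n / 2 ^ l" by (simp add: q_def)
    ultimately show ?thesis unfolding of_nat_add by linarith
  qed
  show ?thesis
  proof (rule dictionary_exists[of l m M s n lam 1613 bD bR b1 b2, folded k_def, OF l0 m2 sM(1) sk nlam lamk rsD rsR b1(2) b2(2)])
    fix enc rk sel
    assume a: "\<And>x. probes k (6 * 1613 + 80) (rk x)" "\<And>i. probes k (6 * 1613 + 80) (sel i)"
      "\<And>S. S \<subseteq> {..<m} \<Longrightarrow> card S = n \<Longrightarrow>
       \<exists>e\<le>n. (s = 0 \<longrightarrow> e = 0) \<and> length (enc S) = lam + n * s + bD e + bR e + b1 e + b2 e"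
      "\<And>S x. S \<subseteq> {..<m} \<Longrightarrow> card S = n \<Longrightarrow> x < m \<Longrightarrow> rk x (list_memory (enc S)) = set_rank x S"
      "\<And>S i. S \<subseteq> {..<m} \<Longrightarrow> card S = n \<Longrightarrow> i < n \<Longrightarrow> sel i (list_memory (enc S)) = sorted_list_of_set S ! i"
    show ?thesis
    proof (rule that[of rk sel enc])
      show "probes k 9758 (rk x)" for x using a(1)[of x] by simp
      show "probes k 9758 (sel i)" for i using a(2)[of i] by simp
      fix S assume S: "S \<subseteq> {..<m}" "card S = n"
      show "real (length (enc S)) \<le> log 2 (real (m choose n)) + 3194 * real n / 2 ^ l + log 2 (real n + 1) + 6"
        using a(3)[OF S] bound by metis
      show "rk x (list_memory (enc S)) = set_rank x S" if "x < m" for x by (rule a(4)[OF S that])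
      show "sel i (list_memory (enc S)) = sorted_list_of_set S ! i" if "i < n" for i by (rule a(5)[OF S that])
    qed
  qed
qed

text \<open>The least admissible \<open>l\<close> is taken. If it exceeds \<open>l0\<close>,
  minimality gives \<open>2 ^ (4 * l) \<le> 16 * log 2 m\<close>, which is \<open>O(w m)\<close>;
  otherwise the window size is a constant.\<close>

lemma window_exponent:
  fixes w :: "nat \<Rightarrow> nat" and l0 :: nat
  assumes "\<And>m. 1 \<le> w m" "(\<lambda>m. real (w m)) \<in> \<Theta>(\<lambda>m. log 2 (real m))"
  obtains C l where "\<And>m. l0 \<le> l m" "\<And>m. m < 2 ^ 2 ^ (4 * l m)" "\<And>m. 1 \<le> m \<Longrightarrow> 2 ^ (4 * l m) \<le> C * w m"
proof -
  from assms(2) have "(\<lambda>m. log 2 (real m)) \<in> O(\<lambda>m. real (w m))"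
    by (simp add: bigtheta_def bigomega_iff_bigo)
  then obtain c where c: "0 < c" "eventually (\<lambda>m. norm (log 2 (real m)) \<le> c * norm (real (w m))) at_top"
    by (rule landau_o.bigE)
  then obtain m0 where m0: "\<And>m. m0 \<le> m \<Longrightarrow> log 2 (real m) \<le> c * real (w m)"
    by (auto simp: eventually_at_top_linorder abs_le_iff)
  \<comment> \<open>The first summand serves \<open>m \<ge> m0\<close>; the second covers the
    finitely many smaller \<open>m\<close>, as \<open>w m\<close> is at least 1.\<close>
  define d where "d = c + log 2 (real m0 + 1)"
  have d: "log 2 (real m) \<le> d * real (w m)" if "1 \<le> m" for m
  proof (cases "m0 \<le> m")
    case True
    have "0 \<le> log 2 (real m0 + 1) * real (w m)" by (intro mult_nonneg_nonneg) auto
    then show ?thesis using m0[OF True] unfolding d_def distrib_right by linarith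
  next
    case False
    have "log 2 (real m) \<le> log 2 (real m0 + 1)" using False that by (intro log_mono) auto
    also have "\<dots> \<le> d * 1" using c(1) by (simp add: d_def)
    also have "\<dots> \<le> d * real (w m)" using assms(1)[of m] c(1)
      by (intro mult_left_mono) (auto simp: d_def intro: add_nonneg_nonneg)
    finally show ?thesis .
  qed
  define l where "l m = (LEAST l. l0 \<le> l \<and> m < 2 ^ 2 ^ (4 * l))" for m :: nat
  have ex: "l0 \<le> l0 + m \<and> m < 2 ^ 2 ^ (4 * (l0 + m))" for m :: nat
  proof -
    have "m < 2 ^ m" by (rule less_exp)
    also have "\<dots> \<le> 2 ^ (4 * (l0 + m))" by (intro power_increasing) auto
    also have "\<dots> < 2 ^ 2 ^ (4 * (l0 + m))" by (rule less_exp)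
    finally show ?thesis by simp
  qed
  have l: "l0 \<le> l m \<and> m < 2 ^ 2 ^ (4 * l m)" for m unfolding l_def using ex by (rule LeastI)
  have "2 ^ (4 * l m) \<le> (2 ^ (4 * l0) + nat \<lceil>16 * d\<rceil>) * w m" if m: "1 \<le> m" for m
  proof (cases "l m = l0")
    case True
    have "2 ^ (4 * l0) * 1 \<le> 2 ^ (4 * l0) * w m" using assms(1) by (intro mult_le_mono2)
    then show ?thesis unfolding True add_mult_distrib by linarith
  next
    case False
    \<comment> \<open>Passing from \<open>l'\<close> to \<open>Suc l'\<close> multiplies the window
      size by 16.\<close>
    then obtain l' where l': "l m = Suc l'" "l0 \<le> l'" using l[of m] by (cases "l m") auto
    have "\<not> m < 2 ^ 2 ^ (4 * l')"
      using not_less_Least[of l' "\<lambda>l. l0 \<le> l \<and> m < 2 ^ 2 ^ (4 * l)"] l' unfolding l_def by auto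
    then have "2 ^ 2 ^ (4 * l') \<le> m" by simp
    then have "real (2 ^ 2 ^ (4 * l')) \<le> real m" by (rule of_nat_mono)
    then have "log 2 (real (2 ^ 2 ^ (4 * l'))) \<le> log 2 (real m)" by (intro log_mono) auto
    then have "real (2 ^ (4 * l')) \<le> log 2 (real m)" by (simp add: log_nat_power)
    then have "16 * real (2 ^ (4 * l')) \<le> 16 * d * real (w m)" using d[OF m] by linarith
    also have "\<dots> \<le> real (nat \<lceil>16 * d\<rceil>) * real (w m)" by (intro mult_right_mono real_nat_ceiling_ge) auto
    finally have "real (16 * 2 ^ (4 * l')) \<le> real (nat \<lceil>16 * d\<rceil> * w m)" by simp
    then have "16 * 2 ^ (4 * l') \<le> nat \<lceil>16 * d\<rceil> * w m" by (rule of_nat_le_iff[THEN iffD1])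
    moreover have "(2::nat) ^ (4 * l m) = 16 * 2 ^ (4 * l')" by (simp add: l'(1) power_add)
    ultimately show ?thesis unfolding add_mult_distrib by linarith
  qed
  then show ?thesis using that l by blast
qed

section \<open>The redundancy as a function of \<open>n\<close> alone\<close>

definition redundancy :: "nat \<Rightarrow> real" where
  "redundancy n = 3194 * real n / log 2 (real n + 1) powr (1/4) + log 2 (real n + 1) + 6"

lemma redundancy_smallo: "redundancy \<in> o(\<lambda>n. real n)"
  unfolding redundancy_def by real_asymp

text \<open>The window size \<open>2 ^ (4 * l)\<close> is at least \<open>log 2 (n + 1)\<close>, so
  \<open>2 ^ l\<close> is at least its fourth root; this removes \<open>m\<close> from the
  bound.\<close>

lemma redundancy_bound:
  assumes "0 < n" "n \<le> m" "m < 2 ^ 2 ^ (4 * l)"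
  shows "3194 * real n / 2 ^ l + log 2 (real n + 1) + 6 \<le> redundancy n"
proof -
  have "real n + 1 \<le> real (2 ^ 2 ^ (4 * l))" using assms by linarith
  then have "log 2 (real n + 1) \<le> log 2 (real (2 ^ 2 ^ (4 * l)))" by (intro log_mono) auto
  also have "\<dots> = (2 ^ l) powr 4" by (simp add: log_nat_power mult.commute flip: power_mult)
  finally have "log 2 (real n + 1) powr (1/4) \<le> ((2 ^ l) powr 4) powr (1/4)"
    by (intro powr_mono2) auto
  then have "log 2 (real n + 1) powr (1/4) \<le> 2 ^ l" unfolding powr_powr by simp
  moreover have "0 < log 2 (real n + 1)" using assms(1) by simp
  then have "0 < log 2 (real n + 1) powr (1/4)" by (metis less_irrefl powr_gt_zero)
  ultimately have "3194 * real n / 2 ^ l \<le> 3194 * real n / log 2 (real n + 1) powr (1/4)"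
    by (intro divide_left_mono mult_pos_pos) auto
  then show ?thesis by (simp add: redundancy_def)
qed

theorem theorem5p1:
  "\<exists>f :: nat \<Rightarrow> real. f \<in> o(\<lambda>n. real n) \<and>
     (\<forall>w :: nat \<Rightarrow> nat.
        (\<forall>m. 1 \<le> w m) \<and> (\<lambda>m. real (w m)) \<in> \<Theta>(\<lambda>m. log 2 (real m)) \<longrightarrow>
        (\<exists>t :: nat. \<forall>m \<ge> 1. \<forall>n \<le> m.
           \<exists>(enc :: nat set \<Rightarrow> bool list)
            (rank_alg :: nat \<Rightarrow> int probe_tree)
            (select_alg :: nat \<Rightarrow> nat probe_tree).
             \<forall>S \<subseteq> {..<m}. card S = n \<longrightarrow>
               real (length (enc S)) \<le> real_of_int (info_bound n m) + f n \<and>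
               (\<forall>x < m. answers_within t (cell (w m) (enc S)) (rank_alg x) (set_rank x S)) \<and>
               (\<forall>i \<in> {1..n}. answers_within t (cell (w m) (enc S)) (select_alg i) (set_select i S))))"
proof (rule exI[of _ redundancy], intro conjI redundancy_smallo allI impI)
  fix w :: "nat \<Rightarrow> nat"
  assume w: "(\<forall>m. 1 \<le> w m) \<and> (\<lambda>m. real (w m)) \<in> \<Theta>(\<lambda>m. log 2 (real m))"
  obtain C l where l: "\<And>m. 14 \<le> l m" "\<And>m. m < 2 ^ 2 ^ (4 * l m)" "\<And>m. 1 \<le> m \<Longrightarrow> 2 ^ (4 * l m) \<le> C * w m"
    by (rule window_exponent[of w 14]) (use w in auto)
  show "\<exists>t. \<forall>m \<ge> 1. \<forall>n \<le> m. \<exists>enc rank_alg select_alg. \<forall>S \<subseteq> {..<m}. card S = n \<longrightarrow>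
     real (length (enc S)) \<le> real_of_int (info_bound n m) + redundancy n \<and>
     (\<forall>x < m. answers_within t (cell (w m) (enc S)) (rank_alg x) (set_rank x S)) \<and>
     (\<forall>i \<in> {1..n}. answers_within t (cell (w m) (enc S)) (select_alg i) (set_select i S))"
  \<comment> \<open>Each of the 9758 windows costs at most \<open>C + 1\<close> cell probes.\<close>
  proof (rule exI[of _ "9758 * Suc C"], intro allI impI)
    fix m n :: nat assume m: "1 \<le> m" and n: "n \<le> m"
    have w0: "0 < w m" using w by (simp add: Suc_le_eq)
    show "\<exists>enc rank_alg select_alg. \<forall>S \<subseteq> {..<m}. card S = n \<longrightarrow>
       real (length (enc S)) \<le> real_of_int (info_bound n m) + redundancy n \<and>
       (\<forall>x < m. answers_within (9758 * Suc C) (cell (w m) (enc S)) (rank_alg x) (set_rank x S)) \<and>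
       (\<forall>i \<in> {1..n}. answers_within (9758 * Suc C) (cell (w m) (enc S)) (select_alg i) (set_select i S))"
    proof (cases "n = 0")
      case True
      have "S = {}" if "S \<subseteq> {..<m}" "card S = n" for S
        using that True finite_subset[OF that(1)] by simp
      then show ?thesis
        using True by (intro exI[of _ "\<lambda>_. []"] exI[of _ "\<lambda>_. Answer (-1)"] exI[of _ "\<lambda>_. Answer 0"])
          (auto simp: answers_within_def set_rank_def info_bound_def redundancy_def)
    next
      case False
      then have n0: "0 < n" by simp
      let ?k = "2 ^ (4 * l m) :: nat"
      obtain enc rk sel where rk: "\<And>x. probes ?k 9758 (rk x)" and sel: "\<And>i. probes ?k 9758 (sel i)"
        and len: "\<And>S. S \<subseteq> {..<m} \<Longrightarrow> card S = n \<Longrightarrow> real (length (enc S))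
          \<le> log 2 (real (m choose n)) + 3194 * real n / 2 ^ l m + log 2 (real n + 1) + 6"
        and rk_ok: "\<And>S x. S \<subseteq> {..<m} \<Longrightarrow> card S = n \<Longrightarrow> x < m \<Longrightarrow> rk x (list_memory (enc S)) = set_rank x S"
        and sel_ok: "\<And>S i. S \<subseteq> {..<m} \<Longrightarrow> card S = n \<Longrightarrow> i < n \<Longrightarrow>
          sel i (list_memory (enc S)) = sorted_list_of_set S ! i"
        using succinct_dictionary[OF l(1,2) n0 n] by metis
      obtain rt where rt: "\<And>x bs. answers_within (9758 * Suc C) (cell (w m) bs) (rt x) (rk x (list_memory bs))"
        using probe_tree_of_probes[OF rk w0 l(3)[OF m]] by metis
      obtain st where st: "\<And>i bs. answers_within (9758 * Suc C) (cell (w m) bs) (st i) (sel i (list_memory bs))"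
        using probe_tree_of_probes[OF sel w0 l(3)[OF m]] by metis
      show ?thesis
      \<comment> \<open>The dictionary counts positions from 0, \<open>set_select\<close> from
        1.\<close>
      proof (rule exI[of _ enc], rule exI[of _ rt], rule exI[of _ "\<lambda>i. st (i - 1)"], intro allI impI conjI ballI)
        fix S assume S: "S \<subseteq> {..<m}" "card S = n"
        have "log 2 (real (m choose n)) \<le> real_of_int (info_bound n m)" by (simp add: info_bound_def)
        then show "real (length (enc S)) \<le> real_of_int (info_bound n m) + redundancy n"
          using len[OF S] redundancy_bound[OF n0 n l(2)] by linarith
        show "answers_within (9758 * Suc C) (cell (w m) (enc S)) (rt x) (set_rank x S)" if "x < m" for x
          using rt[of "enc S" x] rk_ok[OF S that] by simp
        show "answers_within (9758 * Suc C) (cell (w m) (enc S)) (st (i - 1)) (set_select i S)" if "i \<in> {1..n}" for i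
        proof -
          have "i - 1 < n" using that by auto
          from sel_ok[OF S this] st[of "enc S" "i - 1"] show ?thesis by (simp only: set_select_def)
        qed
      qed
    qed
  qed
qed

end
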